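(* Let $s \geq 2$ be a (fixed) integer. Let $(\alpha_t)_{t\in\mathbb{N}}$ with $0<\alpha_t<1$ and $(r_t)_{t \in \mathbb{N}}$ with $r_t \in \mathbb{N}$ be sequences such that $r_t \gg 1/\alpha_t^{2s+1}$, i.e. $r_t\,\alpha_t^{2s+1} \to \infty$ as $t \to \infty$. Then, writing $\alpha = \alpha_t$, $r = r_t$, \[ N^{\mathbb{R}}_{\alpha}(r) \leq \left(1 + \left( \frac{2\alpha}{1-\alpha} \right)^2 + \frac{1 + o(1)}{4 \cos^2 \left(\frac{\pi}{s+2}\right)} \right) r . \] In particular, if $r \geq 1/\alpha^{\omega(1)}$ (i.e. $r_t \geq \alpha_t^{-w_t}$ for some sequence $w_t \to \infty$), then \[ N^{\mathbb{R}}_{\alpha}(r) \leq \left( \frac{5}{4} + \left( \frac{2\alpha}{1-\alpha} \right)^2 + o(1)\right) r . \]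
   Context: $\mathbb{N}$ is the set of positive integers. Lines $l_1,\dots,l_n$ through the origin in $\mathbb{R}^r$ are equiangular with common angle $\arccos(\alpha)$ if, choosing a unit vector $v_i$ along each $l_i$, one has $|\langle v_i, v_j\rangle| = \alpha$ for all $i \neq j$. $N^{\mathbb{R}}_\alpha(r)$ denotes the maximum number of equiangular lines in $\mathbb{R}^r$ with common angle $\arccos(\alpha)$. Asymptotic convention: quantities such as $\alpha, r$ are implicitly functions of an increasing parameter $t\in\mathbb{N}$; $f \ll g$ (equivalently $f=o(g)$, $g = \omega(f)$) means $f(t)/g(t) \to 0$ as $t \to \infty$; $o(1)$ denotes a quantity tending to $0$ as $t\to\infty$. *)

theory Defs
  imports Complex_Main "Jordan_Normal_Form.Matrix"
begin

text \<open>The space \<open>\<real>\<^sup>r\<close> is rendered as \<open>carrier_vec r\<close>, so that the dimension can vary along a sequence.\<close>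

definition lines_through_origin :: "nat \<Rightarrow> real vec set set" where
  "lines_through_origin r =
     {range (\<lambda>c. c \<cdot>\<^sub>v v) | v. v \<in> carrier_vec r \<and> v \<noteq> 0\<^sub>v r}"

text \<open>Each line contains exactly two unit vectors, which differ by a sign, so quantifying over
  all unit vectors is the same as choosing one along each line.\<close>

definition equiangular_lines :: "nat \<Rightarrow> real \<Rightarrow> real vec set set \<Rightarrow> bool" where
  "equiangular_lines r \<alpha> L \<longleftrightarrow>
     L \<subseteq> lines_through_origin r \<and>
     (\<forall>l\<in>L. \<forall>m\<in>L. l \<noteq> m \<longrightarrow>
        (\<forall>u\<in>l. \<forall>v\<in>m. u \<bullet> u = 1 \<longrightarrow> v \<bullet> v = 1 \<longrightarrow> \<bar>u \<bullet> v\<bar> = \<alpha>))"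

text \<open>For \<open>0 \<le> \<alpha> < 1\<close> the lines of an equiangular family are pairwise distinct, so families may
  be taken to be sets, and their sizes are bounded in terms of \<open>r\<close>, so the maximum exists.\<close>

definition max_equiangular :: "real \<Rightarrow> nat \<Rightarrow> nat" where
  "max_equiangular \<alpha> r = Max {card L | L. finite L \<and> equiangular_lines r \<alpha> L}"

end

theory Submission
  imports Defs "HOL-Analysis.L2_Norm" "HOL-Analysis.Convex"
begin

text \<open>Let \<open>\<lambda> = (1 - \<alpha>) / (2\<alpha>)\<close>. Comparing \<open>v\<^sub>i v\<^sub>j\<^sup>T\<close> with combinations of the matrices
  \<open>v\<^sub>k v\<^sub>k\<^sup>T\<close> in the Frobenius norm shows that any two rows of the sign pattern of the Gram matrix
  agree or disagree in all but \<open>O(1 / \<alpha>\<^sup>4)\<close> places, so after changing signs the graph of negative inner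
  products has maximum degree \<open>O(1 / \<alpha>\<^sup>4)\<close>. Since the Gram matrix is positive semidefinite, a nonnegative vector
  with small support has Rayleigh quotient at most \<open>\<lambda> (1 + o(1))\<close> with respect to the adjacency
  matrix. Stars then improve the degree bound to \<open>4\<lambda>\<^sup>2\<close>, and an Alon-Boppana type test vector
  on a ball of radius \<open>s\<close> in the universal cover, pushed down to the graph, bounds the average degree
  by \<open>d - 1 \<le> (1 + o(1)) \<lambda>\<^sup>2 / (4 cos\<^sup>2 (\<pi> / (s + 2)))\<close>. Finally the Gram matrix of the centred
  vectors has rank at most \<open>r\<close>, and comparing its trace with its Frobenius norm gives
  \<open>n - 2 \<le> r (1 + d / \<lambda>\<^sup>2)\<close>.\<close>

section \<open>Test vectors on balls\<close>

text \<open>The exponent \<open>2 s + 1\<close> comes from centring. A vector supported on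
  \<open>W\<close> does not have sum zero, and correcting this costs its Rayleigh quotient at most
  \<open>2 \<Delta> |W| / n\<close>. With \<Delta> of order \<open>1 / \<alpha>^2\<close> and balls
  of size about \<open>\<Delta>^s\<close>, the cost is small against \<lambda>, of order
  \<open>1 / \<alpha>\<close>, once \<open>n \<alpha>^(2 s + 1)\<close> is large. The crude degree
  bound would spoil this; a star with about \<open>4 \<lambda>^2\<close> leaves is small enough to
  work even with the crude \<Delta>, provided \<open>n \<alpha>^5\<close> is large, which
  \<open>s \<ge> 2\<close> ensures. The other obstacle is irregularity: only an average degree is
  given, and non-backtracking walks die at leaves. Passing to a minimal subgraph of the same density
  forces all degrees to be at least 2 when \<open>d \<ge> 2\<close>. Walk weights are chosen so
  that, summed over all roots, every directed edge carries weight 1 at every level. Some root does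
  at least as well as the average, and convexity of \<open>t sqrt (t - 1)\<close> brings in the
  average degree.\<close>

lemma sum_mult_le_sqrt:
  fixes p q :: "'b \<Rightarrow> real"
  assumes "finite I" "sum (\<lambda>i. (p i)\<^sup>2) I \<le> P" "sum (\<lambda>i. (q i)\<^sup>2) I \<le> Q"
  shows "(\<Sum>i\<in>I. p i * q i) \<le> sqrt P * sqrt Q"
proof -
  have "(\<Sum>i\<in>I. p i * q i) \<le> (\<Sum>i\<in>I. \<bar>p i\<bar> * \<bar>q i\<bar>)"
    by (intro sum_mono) (metis abs_mult abs_ge_self)
  also have "\<dots> \<le> L2_set p I * L2_set q I" by (rule L2_set_mult_ineq)
  also have "\<dots> \<le> sqrt P * sqrt Q"
    unfolding L2_set_def using assms order_trans[OF sum_nonneg assms(2)]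
    by (intro mult_mono real_sqrt_le_mono) (auto intro: sum_nonneg)
  finally show ?thesis .
qed

text \<open>The sines are the top eigenvector of the path on \<open>s + 1\<close> vertices, with
  eigenvalue \<open>2 cos \<theta>\<close>. The eigenvector equation is paired with the vector
  itself; the boundary terms vanish because the sine is 0 at 0 and at pi.\<close>

lemma sum_sin_path:
  fixes s :: nat
  defines "\<theta> \<equiv> pi / (real s + 2)"
  shows "(\<Sum>i<s. sin (real (i+1) * \<theta>) * sin (real (i+2) * \<theta>)) =
         cos \<theta> * (\<Sum>i\<le>s. (sin (real (i+1) * \<theta>))\<^sup>2)"
proof -
  define y where "y i = sin (real i * \<theta>)" for i :: nat
  have ylast: "y (s+2) = 0"
  proof -
    have "real (s+2) * \<theta> = pi" unfolding \<theta>_def by (simp add: field_simps)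
    then show ?thesis unfolding y_def by simp
  qed
  have rec: "2 * cos \<theta> * y (i+1) = y i + y (i+2)" for i
  proof -
    have "real (i+2) * \<theta> = real (i+1) * \<theta> + \<theta>" "real i * \<theta> = real (i+1) * \<theta> - \<theta>"
      by (auto simp: algebra_simps)
    then show ?thesis unfolding y_def by (simp only: sin_add sin_diff) simp
  qed
  have "2 * cos \<theta> * (\<Sum>i\<le>s. (y (i+1))\<^sup>2) = (\<Sum>i\<le>s. y (i+1) * (y i + y (i+2)))"
    unfolding rec[symmetric] by (simp add: sum_distrib_left power2_eq_square algebra_simps)
  also have "\<dots> = (\<Sum>i\<le>s. y (i+1) * y i) + (\<Sum>i\<le>s. y (i+1) * y (i+2))"
    by (simp add: algebra_simps sum.distrib)
  also have "(\<Sum>i\<le>s. y (i+1) * y i) = (\<Sum>i<s. y (i+1) * y (i+2))"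
  proof (cases s)
    case 0 then show ?thesis by (simp add: y_def)
  next
    case (Suc m)
    have "(\<Sum>i\<le>s. y (i+1) * y i) = y 1 * y 0 + (\<Sum>i\<le>m. y (i+2) * y (i+1))"
      unfolding Suc by (subst sum.atMost_Suc_shift) (simp add: numeral_2_eq_2)
    then show ?thesis using Suc by (simp add: y_def lessThan_Suc_atMost mult.commute)
  qed
  also have "(\<Sum>i\<le>s. y (i+1) * y (i+2)) = (\<Sum>i<s. y (i+1) * y (i+2))"
    using ylast by (simp add: lessThan_Suc_atMost[symmetric])
  finally show ?thesis unfolding y_def by simp
qed

section \<open>Graphs: degrees, quadratic forms, balls and walk weights\<close>

locale graph =
  fixes E :: "'a \<Rightarrow> 'a \<Rightarrow> bool"
  assumes sym: "E u w \<Longrightarrow> E w u" and irrefl: "\<not> E u u"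
begin

definition adj :: "'a \<Rightarrow> 'a \<Rightarrow> real" where "adj u w = of_bool (E u w)"

definition deg :: "'a set \<Rightarrow> 'a \<Rightarrow> real" where "deg S u = (\<Sum>w\<in>S. adj u w)"

definition vol :: "'a set \<Rightarrow> real" where "vol S = (\<Sum>u\<in>S. deg S u)"

definition quad :: "'a set \<Rightarrow> ('a \<Rightarrow> real) \<Rightarrow> real" where
  "quad S x = (\<Sum>u\<in>S. \<Sum>w\<in>S. adj u w * (x u * x w))"

lemma adj_sym: "adj u w = adj w u"
  using sym by (auto simp: adj_def)

lemma adj_nonneg [simp]: "adj u w \<ge> 0"
  by (simp add: adj_def)

lemma adj_self [simp]: "adj u u = 0"
  by (simp add: adj_def irrefl)

lemma deg_nonneg: "deg S u \<ge> 0"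
  by (simp add: deg_def sum_nonneg)

lemma deg_mono: "finite V \<Longrightarrow> S \<subseteq> V \<Longrightarrow> deg S u \<le> deg V u"
  unfolding deg_def by (intro sum_mono2) auto

lemma deg_card: "finite S \<Longrightarrow> deg S u = real (card {w\<in>S. E u w})"
  unfolding deg_def adj_def by (simp add: of_bool_def sum.If_cases Int_def)

lemma quad_support:
  assumes "finite V" "S \<subseteq> V" "\<And>u. u \<notin> S \<Longrightarrow> x u = 0"
  shows "quad V x = quad S x" "(\<Sum>u\<in>V. (x u)\<^sup>2) = (\<Sum>u\<in>S. (x u)\<^sup>2)"
proof -
  have "quad V x = (\<Sum>u\<in>V. \<Sum>w\<in>S. adj u w * (x u * x w))"
    unfolding quad_def using assms by (intro sum.cong refl sum.mono_neutral_right) auto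
  also have "\<dots> = quad S x"
    unfolding quad_def using assms by (intro sum.mono_neutral_right) auto
  finally show "quad V x = quad S x" .
  show "(\<Sum>u\<in>V. (x u)\<^sup>2) = (\<Sum>u\<in>S. (x u)\<^sup>2)"
    using assms by (intro sum.mono_neutral_right) auto
qed

primrec nball :: "'a set \<Rightarrow> nat \<Rightarrow> 'a \<Rightarrow> 'a set" where
  "nball S 0 v = {v}"
| "nball S (Suc i) v = nball S i v \<union> (\<Union>u\<in>nball S i v. {w\<in>S. E u w})"

lemma nball_subset: "v \<in> S \<Longrightarrow> nball S i v \<subseteq> S"
  by (induction i) auto

lemma nball_mono: "i \<le> j \<Longrightarrow> nball S i v \<subseteq> nball S j v"
  by (induction j) (auto simp: le_Suc_eq)

lemma card_nball_le:
  assumes "finite S" "v \<in> S" "\<And>u. u \<in> S \<Longrightarrow> deg S u \<le> \<Delta>"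
  shows "real (card (nball S i v)) \<le> (1 + \<Delta>) ^ i"
proof (induction i)
  case 0 then show ?case by simp
next
  case (Suc i)
  let ?B = "nball S i v"
  have fin: "finite ?B" using nball_subset[OF assms(2)] assms(1) finite_subset by blast
  have \<Delta>: "\<Delta> \<ge> 0" using assms(2,3) deg_nonneg order_trans by blast
  have "card (nball S (Suc i) v) \<le> card ?B + (\<Sum>u\<in>?B. card {w\<in>S. E u w})"
    using card_Un_le[of ?B] card_UN_le[OF fin, of "\<lambda>u. {w\<in>S. E u w}"]
    by (simp) (meson add_left_mono order_trans)
  then have "real (card (nball S (Suc i) v)) \<le> real (card ?B) + (\<Sum>u\<in>?B. deg S u)"
    unfolding deg_card[OF assms(1)] by (metis of_nat_add of_nat_le_iff of_nat_sum)
  also have "(\<Sum>u\<in>?B. deg S u) \<le> real (card ?B) * \<Delta>"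
    using nball_subset[OF assms(2)] assms(3) by (intro sum_bounded_above) auto
  also have "real (card ?B) + real (card ?B) * \<Delta> = (1 + \<Delta>) * real (card ?B)"
    by (simp add: algebra_simps)
  also have "\<dots> \<le> (1 + \<Delta>) * (1 + \<Delta>) ^ i" using Suc \<Delta> by (intro mult_left_mono) auto
  finally show ?case by simp
qed

text \<open>\<open>flow S v i a b\<close> is the total weight of the non-backtracking walks of length \<open>i\<close> from \<open>v\<close>
  with last step \<open>(a, b)\<close>, where a walk has weight \<open>\<Prod> 1 / (deg u - 1)\<close> over its
  inner vertices \<open>u\<close> (its initial vertex counts as inner: a walk is thought of as starting with
  an arbitrary step into \<open>v\<close>).\<close>

primrec flow :: "'a set \<Rightarrow> 'a \<Rightarrow> nat \<Rightarrow> 'a \<Rightarrow> 'a \<Rightarrow> real" where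
  "flow S v 0 a b = adj a b * of_bool (b = v)"
| "flow S v (Suc i) a b = adj a b * (((\<Sum>c\<in>S. flow S v i c a) - flow S v i b a) / (deg S a - 1))"

section \<open>The projected test vector in a subgraph of minimum degree 2\<close>

context
  fixes S :: "'a set"
  assumes fin: "finite S" and deg2: "\<And>u. u \<in> S \<Longrightarrow> deg S u \<ge> 2"
begin

lemma flow_nonneg: "a \<in> S \<Longrightarrow> b \<in> S \<Longrightarrow> flow S v i a b \<ge> 0"
proof (induction i arbitrary: a b)
  case 0 then show ?case by simp
next
  case (Suc i)
  have "flow S v i b a \<le> (\<Sum>c\<in>S. flow S v i c a)"
    using Suc fin by (intro member_le_sum) auto
  then show ?case using deg2[OF Suc.prems(1)] by simp
qed

text \<open>Uniform weight on directed edges is stationary for the non-backtracking walk: the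
  \<open>deg S a - 1\<close> edges entering \<open>a\<close> from elsewhere than \<open>b\<close>
  each pass on an equal share. This makes the average over roots exact without regularity.\<close>

lemma sum_flow: "a \<in> S \<Longrightarrow> b \<in> S \<Longrightarrow> (\<Sum>v\<in>S. flow S v i a b) = adj a b"
proof (induction i arbitrary: a b)
  case 0
  then show ?case using fin by (simp add: sum_distrib_left[symmetric] of_bool_def)
next
  case (Suc i)
  have "(\<Sum>v\<in>S. flow S v (Suc i) a b)
      = adj a b * ((\<Sum>v\<in>S. (\<Sum>c\<in>S. flow S v i c a) - flow S v i b a) / (deg S a - 1))"
    by (simp add: sum_distrib_left sum_divide_distrib)
  also have "(\<Sum>v\<in>S. (\<Sum>c\<in>S. flow S v i c a) - flow S v i b a)
      = (\<Sum>c\<in>S. \<Sum>v\<in>S. flow S v i c a) - (\<Sum>v\<in>S. flow S v i b a)"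
    by (simp add: sum_subtractf) (rule sum.swap)
  also have "\<dots> = (\<Sum>c\<in>S. adj c a) - adj b a"
    using Suc by simp
  also have "\<dots> = deg S a - adj a b"
    unfolding deg_def using adj_sym by auto
  finally show ?case using deg2[OF Suc.prems(1)] by (auto simp: adj_def)
qed

lemma flow_support: "b \<in> S \<Longrightarrow> a \<in> S \<Longrightarrow> flow S v i a b \<noteq> 0 \<Longrightarrow> b \<in> nball S i v"
proof (induction i arbitrary: a b)
  case 0 then show ?case by simp
next
  case (Suc i)
  then have E: "E a b" by (auto simp: adj_def)
  have "a \<in> nball S i v"
  proof (rule ccontr)
    assume "a \<notin> nball S i v"
    then have "flow S v i c a = 0" if "c \<in> S" for c using Suc.IH Suc.prems(2) that by blast
    then have "flow S v (Suc i) a b = 0" using Suc.prems(1) by simp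
    with Suc.prems show False by simp
  qed
  then show ?case using E Suc.prems(1) by auto
qed

text \<open>The test vector on the universal cover gives a walk \<open>p\<close> of length \<open>i\<close> the value
  \<open>y i * sqrt (weight p)\<close>; \<open>amp\<close> is its \<open>\<ell>\<^sup>2\<close>-projection to the graph.\<close>

definition amp :: "nat \<Rightarrow> (nat \<Rightarrow> real) \<Rightarrow> 'a \<Rightarrow> 'a \<Rightarrow> real" where
  "amp s y v u = (if u \<in> S then sqrt (\<Sum>i\<le>s. (y i)\<^sup>2 * (\<Sum>a\<in>S. flow S v i a u)) else 0)"

lemma amp_nonneg: "amp s y v u \<ge> 0"
  unfolding amp_def by (auto intro!: sum_nonneg mult_nonneg_nonneg flow_nonneg)

lemma amp_sq: "u \<in> S \<Longrightarrow> (amp s y v u)\<^sup>2 = (\<Sum>i\<le>s. (y i)\<^sup>2 * (\<Sum>a\<in>S. flow S v i a u))"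
  unfolding amp_def by (auto intro!: real_sqrt_pow2 sum_nonneg mult_nonneg_nonneg flow_nonneg)

lemma amp_support: "u \<notin> nball S s v \<Longrightarrow> amp s y v u = 0"
proof -
  assume u: "u \<notin> nball S s v"
  have "flow S v i a u = 0" if "u \<in> S" "i \<le> s" "a \<in> S" for i a
    using flow_support[OF that(1,3)] nball_mono[OF that(2)] u by blast
  then show ?thesis unfolding amp_def by simp
qed

text \<open>Two disjoint kinds of walks ending at \<open>u\<close> are kept: those that can be
  continued to \<open>w\<close>, and those whose last step came from \<open>w\<close>. They are the
  endpoints over \<open>u\<close> of the two kinds of tree edges over the edge \<open>u w\<close>.
  The walks of length \<open>s\<close> of the first kind and of length 0 of the second belong to no
  such edge and are dropped.\<close>

lemma amp_sq_ge:
  assumes "u \<in> S" "w \<in> S" "E u w"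
  shows "(\<Sum>i<s. (y i)\<^sup>2 * ((deg S u - 1) * flow S v (Suc i) u w)
            + (y (Suc i))\<^sup>2 * flow S v (Suc i) w u) \<le> (amp s y v u)\<^sup>2"
proof -
  have step: "(deg S u - 1) * flow S v (Suc i) u w = (\<Sum>a\<in>S. flow S v i a u) - flow S v i w u" for i
    using deg2[OF assms(1)] assms(3) by (simp add: adj_def)
  have nn: "(\<Sum>a\<in>S. flow S v i a u) - flow S v i w u \<ge> 0" for i
    using member_le_sum[OF assms(2), of "\<lambda>a. flow S v i a u"] flow_nonneg assms(1) fin by simp
  have "(amp s y v u)\<^sup>2 = (\<Sum>i\<le>s. (y i)\<^sup>2 * ((\<Sum>a\<in>S. flow S v i a u) - flow S v i w u))
          + (\<Sum>i\<le>s. (y i)\<^sup>2 * flow S v i w u)"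
    unfolding amp_sq[OF assms(1)] by (simp add: sum.distrib[symmetric] algebra_simps)
  moreover have "(\<Sum>i\<le>s. (y i)\<^sup>2 * ((\<Sum>a\<in>S. flow S v i a u) - flow S v i w u)) \<ge>
     (\<Sum>i<s. (y i)\<^sup>2 * ((\<Sum>a\<in>S. flow S v i a u) - flow S v i w u))"
    using nn by (intro sum_mono2) auto
  moreover have "(\<Sum>i\<le>s. (y i)\<^sup>2 * flow S v i w u) \<ge> (\<Sum>i<s. (y (Suc i))\<^sup>2 * flow S v (Suc i) w u)"
    unfolding lessThan_Suc_atMost[symmetric] sum.lessThan_Suc_shift
    using flow_nonneg[of w u v 0] assms by simp
  ultimately show ?thesis unfolding sum.distrib step by linarith
qed

text \<open>Cauchy-Schwarz over the tree edges lying above \<open>u w\<close>: the index is the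
  level together with the direction of the step, and \<open>p\<close>, \<open>q\<close> hold the
  values at the ends over \<open>u\<close> and \<open>w\<close>. A parent has \<open>deg - 1\<close>
  times the weight of its child, whence the factor \<open>sqrt (deg - 1)\<close>.\<close>

lemma amp_edge:
  assumes "u \<in> S" "w \<in> S" "E u w"
  shows "(\<Sum>i<s. y i * y (Suc i) * (sqrt (deg S u - 1) * flow S v (Suc i) u w
            + sqrt (deg S w - 1) * flow S v (Suc i) w u)) \<le> amp s y v u * amp s y v w"
proof -
  define p where "p = (\<lambda>(i, b). if b then y i * sqrt ((deg S u - 1) * flow S v (Suc i) u w)
      else y (Suc i) * sqrt (flow S v (Suc i) w u))"
  define q where "q = (\<lambda>(i, b). if b then y (Suc i) * sqrt (flow S v (Suc i) u w)
      else y i * sqrt ((deg S w - 1) * flow S v (Suc i) w u))"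
  let ?I = "{..<s} \<times> (UNIV :: bool set)"
  have nn: "flow S v j u w \<ge> 0" "flow S v j w u \<ge> 0" "deg S u - 1 \<ge> 0" "deg S w - 1 \<ge> 0" for j
    using flow_nonneg assms deg2[of u] deg2[of w] by auto
  have split: "(\<Sum>z\<in>?I. f z) = (\<Sum>i<s. f (i, True) + f (i, False))" for f :: "nat \<times> bool \<Rightarrow> real"
    by (simp add: sum.cartesian_product' UNIV_bool add.commute)
  have p2: "(\<Sum>z\<in>?I. (p z)\<^sup>2) \<le> (amp s y v u)\<^sup>2"
    unfolding split p_def using amp_sq_ge[OF assms] nn
    by (simp add: power_mult_distrib del: flow.simps)
  have q2: "(\<Sum>z\<in>?I. (q z)\<^sup>2) \<le> (amp s y v w)\<^sup>2"
    unfolding split q_def using amp_sq_ge[OF assms(2,1) sym[OF assms(3)]] nn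
    by (simp add: power_mult_distrib add.commute del: flow.simps)
  have "(\<Sum>z\<in>?I. p z * q z) \<le> amp s y v u * amp s y v w"
    using sum_mult_le_sqrt[OF _ p2 q2] amp_nonneg by simp
  also have "(\<Sum>z\<in>?I. p z * q z) = (\<Sum>i<s. y i * y (Suc i) * (sqrt (deg S u - 1) * flow S v (Suc i) u w
            + sqrt (deg S w - 1) * flow S v (Suc i) w u))"
  proof -
    have sq: "sqrt (c * f) * sqrt f = sqrt c * f" "sqrt f * sqrt (c * f) = sqrt c * f" if "f \<ge> 0" for c f :: real
      using that by (simp_all add: real_sqrt_mult)
    have "p (i, True) * q (i, True) = y i * y (Suc i) * (sqrt (deg S u - 1) * flow S v (Suc i) u w)" for i
      unfolding p_def q_def using sq[OF nn(1)] by (simp del: flow.simps)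
    moreover have "p (i, False) * q (i, False) = y i * y (Suc i) * (sqrt (deg S w - 1) * flow S v (Suc i) w u)" for i
      unfolding p_def q_def using sq[OF nn(2)] by (simp del: flow.simps)
    ultimately show ?thesis unfolding split by (simp add: distrib_left)
  qed
  finally show ?thesis .
qed

lemma sum_amp_sq:
  "(\<Sum>v\<in>S. \<Sum>u\<in>S. (amp s y v u)\<^sup>2) = (\<Sum>i\<le>s. (y i)\<^sup>2) * vol S"
proof -
  have "(\<Sum>v\<in>S. \<Sum>u\<in>S. (amp s y v u)\<^sup>2)
      = (\<Sum>v\<in>S. \<Sum>u\<in>S. \<Sum>i\<le>s. (y i)\<^sup>2 * (\<Sum>a\<in>S. flow S v i a u))"
    by (intro sum.cong refl amp_sq)
  also have "\<dots> = (\<Sum>u\<in>S. \<Sum>v\<in>S. \<Sum>i\<le>s. (y i)\<^sup>2 * (\<Sum>a\<in>S. flow S v i a u))"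
    by (rule sum.swap)
  also have "\<dots> = (\<Sum>u\<in>S. \<Sum>i\<le>s. \<Sum>v\<in>S. (y i)\<^sup>2 * (\<Sum>a\<in>S. flow S v i a u))"
    by (intro sum.cong refl sum.swap)
  also have "\<dots> = (\<Sum>u\<in>S. \<Sum>i\<le>s. (y i)\<^sup>2 * (\<Sum>a\<in>S. \<Sum>v\<in>S. flow S v i a u))"
    unfolding sum_distrib_left[symmetric]
    by (intro sum.cong refl arg_cong2[where f = "(*)"] sum.swap)
  also have "\<dots> = (\<Sum>u\<in>S. \<Sum>i\<le>s. (y i)\<^sup>2 * deg S u)"
    unfolding deg_def by (intro sum.cong refl arg_cong2[where f = "(*)"]) (simp add: sum_flow adj_sym)
  also have "\<dots> = (\<Sum>i\<le>s. (y i)\<^sup>2) * vol S"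
    unfolding vol_def by (subst sum.swap) (simp add: sum_product)
  finally show ?thesis .
qed

text \<open>Summing \<open>amp_edge\<close> over the roots replaces every flow by 1 through
  \<open>sum_flow\<close>. Each directed edge then contributes once from either end of the ordered
  pair, which gives the factor 2.\<close>

lemma sum_quad_amp_ge:
  "2 * (\<Sum>i<s. y i * y (Suc i)) * (\<Sum>u\<in>S. deg S u * sqrt (deg S u - 1)) \<le> (\<Sum>v\<in>S. quad S (amp s y v))"
proof -
  let ?f = "\<lambda>v u w i. y i * y (Suc i) * (sqrt (deg S u - 1) * flow S v (Suc i) u w
            + sqrt (deg S w - 1) * flow S v (Suc i) w u)"
  let ?r = "\<lambda>u. sqrt (deg S u - 1)"
  let ?Y = "\<Sum>i<s. y i * y (Suc i)"
  have "(\<Sum>v\<in>S. quad S (amp s y v)) \<ge> (\<Sum>v\<in>S. \<Sum>u\<in>S. \<Sum>w\<in>S. adj u w * (\<Sum>i<s. ?f v u w i))"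
    unfolding quad_def
  proof (intro sum_mono)
    fix v u w assume "u \<in> S" "w \<in> S"
    then show "adj u w * (\<Sum>i<s. ?f v u w i) \<le> adj u w * (amp s y v u * amp s y v w)"
      using amp_edge[of u w y v s] by (cases "E u w") (simp_all add: adj_def del: flow.simps)
  qed
  moreover have "(\<Sum>v\<in>S. \<Sum>u\<in>S. \<Sum>w\<in>S. adj u w * (\<Sum>i<s. ?f v u w i))
      = 2 * ?Y * (\<Sum>u\<in>S. deg S u * ?r u)"
  proof -
    have "(\<Sum>v\<in>S. \<Sum>u\<in>S. \<Sum>w\<in>S. adj u w * (\<Sum>i<s. ?f v u w i))
       = (\<Sum>u\<in>S. \<Sum>w\<in>S. \<Sum>v\<in>S. adj u w * (\<Sum>i<s. ?f v u w i))"
      by (subst sum.swap) (intro sum.cong refl sum.swap)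
    also have "\<dots> = (\<Sum>u\<in>S. \<Sum>w\<in>S. adj u w * (\<Sum>i<s. \<Sum>v\<in>S. ?f v u w i))"
      by (intro sum.cong refl, simp only: sum_distrib_left) (rule sum.swap)
    also have "\<dots> = (\<Sum>u\<in>S. \<Sum>w\<in>S. adj u w * (\<Sum>i<s. y i * y (Suc i) * (?r u * adj u w + ?r w * adj w u)))"
      by (intro sum.cong refl arg_cong2[where f = "(*)"])
         (simp add: sum_distrib_left[symmetric] sum.distrib sum_flow del: flow.simps)
    also have "\<dots> = (\<Sum>u\<in>S. \<Sum>w\<in>S. ?Y * (adj u w * ?r u + adj w u * ?r w))"
      by (intro sum.cong refl) (auto simp: sum_distrib_right[symmetric] adj_def sym)
    also have "\<dots> = ?Y * ((\<Sum>u\<in>S. \<Sum>w\<in>S. adj u w * ?r u) + (\<Sum>u\<in>S. \<Sum>w\<in>S. adj w u * ?r w))"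
      by (simp add: sum_distrib_left[symmetric] sum.distrib)
    also have "(\<Sum>u\<in>S. \<Sum>w\<in>S. adj w u * ?r w) = (\<Sum>w\<in>S. \<Sum>u\<in>S. adj w u * ?r w)"
      by (rule sum.swap)
    also have "(\<Sum>u\<in>S. \<Sum>w\<in>S. adj u w * ?r u) = (\<Sum>u\<in>S. deg S u * ?r u)"
      by (intro sum.cong refl) (simp only: deg_def sum_distrib_right)
    also have "?Y * ((\<Sum>u\<in>S. deg S u * ?r u) + (\<Sum>u\<in>S. deg S u * ?r u))
        = 2 * ?Y * (\<Sum>u\<in>S. deg S u * ?r u)" by (simp only: distrib_left mult_2 distrib_right)
    finally show ?thesis .
  qed
  ultimately show ?thesis by simp
qed

text \<open>Jensen's inequality for \<open>t sqrt (t - 1)\<close>, in the form of the tangent at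
  \<open>d\<close>, whose slope is \<open>p + k\<close>. The gap to the tangent factors with a
  square, and its other factor is nonnegative because \<open>p \<ge> 1\<close>. Since
  \<open>k \<ge> 0\<close>, a volume above \<open>d * card S\<close> only helps.\<close>

lemma sum_deg_sqrt_ge:
  fixes d :: real
  assumes "d \<ge> 2" "vol S \<ge> d * card S"
  shows "(\<Sum>u\<in>S. deg S u * sqrt (deg S u - 1)) \<ge> sqrt (d - 1) * vol S"
proof -
  define p where "p = sqrt (d - 1)"
  define k where "k = (p\<^sup>2 + 1) / (2 * p)"
  have p1: "p \<ge> 1" and pd: "p\<^sup>2 = d - 1" using assms(1) unfolding p_def by auto
  have k: "k \<ge> 0" using p1 unfolding k_def by simp
  have "deg S u * (sqrt (deg S u - 1) - p) \<ge> k * (deg S u - d)" if u: "u \<in> S" for u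
  proof -
    define q where "q = sqrt (deg S u - 1)"
    have q: "q \<ge> 0" "deg S u = q\<^sup>2 + 1" using deg2[OF u] unfolding q_def by auto
    have "(q\<^sup>2 + 1) * (q - p) - k * (q\<^sup>2 + 1 - d) = (q - p)\<^sup>2 * (q + (p\<^sup>2 - 1) / (2 * p))"
    proof -
      define e where "e = (p\<^sup>2 - 1) / (2 * p)"
      have "2 * p * k = p\<^sup>2 + 1" "2 * p * e = p\<^sup>2 - 1" "d = p\<^sup>2 + 1"
        using p1 pd unfolding k_def e_def by auto
      then have "2 * p * ((q\<^sup>2 + 1) * (q - p) - k * (q\<^sup>2 + 1 - d))
          = 2 * p * (q\<^sup>2 + 1) * (q - p) - (p\<^sup>2 + 1) * (q\<^sup>2 - p\<^sup>2)"
        by (simp add: right_diff_distrib mult.assoc[symmetric])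
      also have "\<dots> = (q - p)\<^sup>2 * (2 * p * q + (p\<^sup>2 - 1))"
        by (simp add: algebra_simps power2_eq_square)
      also have "\<dots> = 2 * p * ((q - p)\<^sup>2 * (q + e))"
        using \<open>2 * p * e = p\<^sup>2 - 1\<close> by (simp add: distrib_left mult.left_commute mult.assoc)
      finally have "2 * p * ((q\<^sup>2 + 1) * (q - p) - k * (q\<^sup>2 + 1 - d)) = 2 * p * ((q - p)\<^sup>2 * (q + e))" .
      then show ?thesis using p1 unfolding e_def by simp
    qed
    moreover have "\<dots> \<ge> 0" using p1 q by simp
    ultimately show ?thesis using q unfolding q_def[symmetric] by simp
  qed
  then have "(\<Sum>u\<in>S. deg S u * (sqrt (deg S u - 1) - p)) \<ge> (\<Sum>u\<in>S. k * (deg S u - d))"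
    by (rule sum_mono)
  moreover have "(\<Sum>u\<in>S. k * (deg S u - d)) = k * (vol S - d * card S)"
    unfolding vol_def by (simp add: sum_distrib_left[symmetric] sum_subtractf)
  moreover have "\<dots> \<ge> 0" using k assms(2) by simp
  moreover have "(\<Sum>u\<in>S. deg S u * (sqrt (deg S u - 1) - p)) = (\<Sum>u\<in>S. deg S u * sqrt (deg S u - 1)) - p * vol S"
    unfolding vol_def by (simp add: algebra_simps sum_subtractf sum_distrib_left)
  ultimately show ?thesis unfolding p_def by linarith
qed

lemma exists_ball_vector:
  fixes d :: real
  assumes "S \<noteq> {}" "d \<ge> 2" "vol S \<ge> d * card S"
  shows "\<exists>v\<in>S. \<exists>x. (\<forall>u. x u \<ge> 0) \<and> (\<forall>u. u \<notin> nball S s v \<longrightarrow> x u = 0) \<and> (\<Sum>u\<in>S. (x u)\<^sup>2) > 0 \<and>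
     quad S x \<ge> 2 * cos (pi / (real s + 2)) * sqrt (d - 1) * (\<Sum>u\<in>S. (x u)\<^sup>2)"
proof -
  define \<theta> where "\<theta> = pi / (real s + 2)"
  define y where "y i = sin (real (i + 1) * \<theta>)" for i :: nat
  define \<mu> where "\<mu> = 2 * cos \<theta> * sqrt (d - 1)"
  define Y where "Y = (\<Sum>i\<le>s. (y i)\<^sup>2)"
  have \<theta>: "0 < \<theta>" "\<theta> \<le> pi / 2" unfolding \<theta>_def by (auto simp: field_simps)
  have cos0: "cos \<theta> \<ge> 0" using \<theta> by (intro cos_ge_zero) auto
  have y0: "y 0 > 0" unfolding y_def using \<theta> pi_gt_zero by (intro sin_gt_zero) auto
  have path: "(\<Sum>i<s. y i * y (Suc i)) = cos \<theta> * Y"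
    using sum_sin_path[of s] unfolding Y_def y_def \<theta>_def by (simp add: add.commute)
  have "\<mu> * (Y * vol S) = 2 * (cos \<theta> * Y) * (sqrt (d - 1) * vol S)"
    unfolding \<mu>_def by simp
  also have "\<dots> \<le> 2 * (cos \<theta> * Y) * (\<Sum>u\<in>S. deg S u * sqrt (deg S u - 1))"
    using cos0 by (intro mult_left_mono sum_deg_sqrt_ge assms) (auto simp: Y_def sum_nonneg)
  also have "\<dots> \<le> (\<Sum>v\<in>S. quad S (amp s y v))"
    using sum_quad_amp_ge[of y s] unfolding path .
  finally have "(\<Sum>v\<in>S. \<mu> * (\<Sum>u\<in>S. (amp s y v u)\<^sup>2)) \<le> (\<Sum>v\<in>S. quad S (amp s y v))"
    using sum_amp_sq[of s y] unfolding Y_def sum_distrib_left[symmetric] by simp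
  then have "\<not> (\<forall>v\<in>S. quad S (amp s y v) < \<mu> * (\<Sum>u\<in>S. (amp s y v u)\<^sup>2))"
    using sum_strict_mono[OF fin assms(1), of "\<lambda>v. quad S (amp s y v)"
        "\<lambda>v. \<mu> * (\<Sum>u\<in>S. (amp s y v u)\<^sup>2)"] by fastforce
  then obtain v where v: "v \<in> S" "\<mu> * (\<Sum>u\<in>S. (amp s y v u)\<^sup>2) \<le> quad S (amp s y v)"
    by (meson not_le)
  \<comment> \<open>The inequality obtained for \<open>v\<close> would hold trivially for the zero
    vector. The level-0 term at the root itself shows that the vector is nonzero.\<close>
  have "deg S v = (\<Sum>a\<in>S. flow S v 0 a v)"
    unfolding deg_def by (simp add: adj_sym)
  moreover have "(y 0)\<^sup>2 * (\<Sum>a\<in>S. flow S v 0 a v) \<le> (amp s y v v)\<^sup>2"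
    unfolding amp_sq[OF v(1)] using v(1)
    by (intro member_le_sum[of 0 _ "\<lambda>i. (y i)\<^sup>2 * (\<Sum>a\<in>S. flow S v i a v)"])
       (auto intro!: sum_nonneg mult_nonneg_nonneg flow_nonneg simp del: flow.simps)
  ultimately have "(amp s y v v)\<^sup>2 \<ge> (y 0)\<^sup>2 * deg S v" by simp
  moreover have "(y 0)\<^sup>2 * deg S v > 0" using y0 deg2[OF v(1)] by simp
  moreover have "(\<Sum>u\<in>S. (amp s y v u)\<^sup>2) \<ge> (amp s y v v)\<^sup>2"
    using fin v(1) by (intro member_le_sum) auto
  ultimately have "(\<Sum>u\<in>S. (amp s y v u)\<^sup>2) > 0" by linarith
  then show ?thesis using v amp_nonneg amp_support unfolding \<mu>_def \<theta>_def by blast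
qed

end
end

section \<open>Local spectral radius and average degree\<close>

text \<open>Trees with \<open>tree_size s\<close> vertices have average degree at least \<open>2 cos (\<pi> / (s + 2))\<close>.\<close>

definition tree_size :: "nat \<Rightarrow> nat" where
  "tree_size s = nat \<lceil>1 / (1 - cos (pi / (real s + 2)))\<rceil>"

lemma cos_path_less_1: "cos (pi / (real s + 2)) < 1"
proof -
  have "pi / (real s + 2) \<le> pi / 1" by (intro divide_left_mono) auto
  moreover have "0 < pi / (real s + 2)" by simp
  ultimately show ?thesis using cos_monotone_0_pi[of 0 "pi / (real s + 2)"] by simp
qed

lemma tree_size: "tree_size s \<ge> 1" "2 * cos (pi / (real s + 2)) * real (tree_size s) \<le> 2 * (real (tree_size s) - 1)"
proof -
  let ?c = "cos (pi / (real s + 2))"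
  have c: "?c < 1" by (rule cos_path_less_1)
  then have ge: "real (tree_size s) \<ge> 1 / (1 - ?c)" unfolding tree_size_def by linarith
  moreover have "1 / (1 - ?c) > 0" using c by simp
  ultimately show "tree_size s \<ge> 1" by linarith
  from ge c have "real (tree_size s) * (1 - ?c) \<ge> 1" by (simp add: field_simps)
  then show "2 * ?c * real (tree_size s) \<le> 2 * (real (tree_size s) - 1)" by (simp add: algebra_simps)
qed

section \<open>Minimal dense subgraphs and local test vectors\<close>

context graph
begin

lemma vol_insert:
  assumes "finite T" "w \<notin> T"
  shows "vol (insert w T) = vol T + 2 * deg T w"
proof -
  have "vol (insert w T) = deg (insert w T) w + (\<Sum>u\<in>T. deg T u + adj u w)"
    unfolding vol_def deg_def using assms by (simp add: add.commute)
  also have "\<dots> = deg T w + (vol T + (\<Sum>u\<in>T. adj w u))"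
    using assms by (simp add: vol_def deg_def sum.distrib adj_sym)
  finally show ?thesis by (simp add: deg_def)
qed

lemma vol_split:
  assumes "finite S" "T \<subseteq> S"
  shows "vol S = vol T + vol (S - T) + 2 * (\<Sum>u\<in>T. deg (S - T) u)"
proof -
  have deg: "deg S u = deg T u + deg (S - T) u" for u
    unfolding deg_def using sum.subset_diff[OF assms(2,1), of "adj u"] by simp
  have "vol S = (\<Sum>u\<in>S - T. deg S u) + (\<Sum>u\<in>T. deg S u)"
    unfolding vol_def by (rule sum.subset_diff[OF assms(2,1)])
  also have "\<dots> = vol (S - T) + (\<Sum>u\<in>S - T. deg T u) + vol T + (\<Sum>u\<in>T. deg (S - T) u)"
    unfolding deg by (simp add: sum.distrib vol_def)
  also have "(\<Sum>u\<in>S - T. deg T u) = (\<Sum>u\<in>T. deg (S - T) u)"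
    unfolding deg_def by (subst sum.swap) (simp add: adj_sym)
  finally show ?thesis by simp
qed

lemma exists_minimal_dense:
  fixes d :: real
  assumes "finite V" "V \<noteq> {}" "vol V \<ge> d * card V"
  obtains S where "S \<subseteq> V" "S \<noteq> {}" "vol S \<ge> d * card S"
    "\<And>T. T \<subset> S \<Longrightarrow> T \<noteq> {} \<Longrightarrow> vol T < d * card T"
proof -
  define P where "P = {S. S \<subseteq> V \<and> S \<noteq> {} \<and> vol S \<ge> d * card S}"
  have "finite P" using assms(1) unfolding P_def by (auto intro: finite_subset[of _ "Pow V"])
  moreover have "P \<noteq> {}" using assms unfolding P_def by auto
  ultimately have "\<exists>S\<in>P. \<forall>T\<in>P. T \<subseteq> S \<longrightarrow> S = T" by (rule finite_has_minimal)
  then obtain S where SP: "S \<in> P" and min: "\<forall>T\<in>P. T \<subseteq> S \<longrightarrow> S = T" by blast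
  have S: "S \<subseteq> V" "S \<noteq> {}" "vol S \<ge> d * card S" using SP unfolding P_def by auto
  have "vol T < d * card T" if "T \<subset> S" "T \<noteq> {}" for T
  proof (rule ccontr)
    assume "\<not> vol T < d * card T"
    then have "T \<in> P" using that S(1) unfolding P_def by auto
    then show False using min that by blast
  qed
  then show ?thesis using that[OF S] by blast
qed

text \<open>Deleting \<open>u\<close> lowers the volume by twice its degree, so a vertex of degree
  at most 1 could be removed without lowering the density below \<open>d\<close>.\<close>

lemma minimal_dense_deg:
  fixes d :: real
  assumes "finite S" "vol S \<ge> d * card S" "d \<ge> 2"
    and "\<And>T. T \<subset> S \<Longrightarrow> T \<noteq> {} \<Longrightarrow> vol T < d * card T" and "u \<in> S"
  shows "deg S u \<ge> 2"
proof -
  let ?T = "S - {u}"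
  have S: "insert u ?T = S" using assms(5) by auto
  have volS: "vol S = vol ?T + 2 * deg S u"
    using vol_insert[of ?T u] assms(1) sum.remove[OF assms(1,5), of "adj u"] unfolding S
    by (simp add: deg_def)
  have card: "real (card S) = real (card ?T) + 1"
    using assms(1,5) by (metis S card_insert_disjoint Diff_iff finite_Diff insertI1 of_nat_Suc add.commute)
  have "vol ?T \<le> d * card ?T"
  proof (cases "?T = {}")
    case True
    show ?thesis unfolding True by (simp add: vol_def)
  next
    case False
    moreover have "?T \<subset> S" using assms(5) by blast
    ultimately show ?thesis using assms(4)[of ?T] by simp
  qed
  then have "2 * deg S u \<ge> d" using assms(2) volS card by (simp add: algebra_simps)
  \<comment> \<open>Degree 1 is compatible with \<open>2 * deg S u \<ge> d\<close> only for
    \<open>d = 2\<close>. Then the rest of \<open>S\<close> is just as dense, against minimality,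
    unless it is empty, and an isolated vertex has degree 0.\<close>
  moreover have "deg S u \<noteq> 1" if "2 * deg S u = 2"
  proof
    assume "deg S u = 1"
    then have "d = 2" "vol ?T = d * card ?T"
      using that \<open>vol ?T \<le> d * card ?T\<close> assms(2,3) volS card \<open>2 * deg S u \<ge> d\<close> by (auto simp: algebra_simps)
    moreover have "?T \<noteq> {}"
    proof
      assume "?T = {}"
      then have "S = {u}" using S by auto
      then show False using \<open>deg S u = 1\<close> by (simp add: deg_def)
    qed
    ultimately show False using assms(4)[of ?T] assms(5) by auto
  qed
  ultimately have "deg S u \<ge> 1" "deg S u \<noteq> 1" using assms(3) by auto
  then have "card {w\<in>S. E u w} \<ge> 2" unfolding deg_card[OF assms(1)] by linarith
  then show ?thesis unfolding deg_card[OF assms(1)] by simp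
qed

text \<open>A minimal dense set is connected, so it contains trees of every size.\<close>

lemma minimal_dense_tree:
  fixes d :: real
  assumes "finite S" "vol S \<ge> d * card S"
    and "\<And>T. T \<subset> S \<Longrightarrow> T \<noteq> {} \<Longrightarrow> vol T < d * card T"
  shows "Suc k \<le> card S \<Longrightarrow> \<exists>T\<subseteq>S. card T = Suc k \<and> vol T \<ge> 2 * real k"
proof (induction k)
  case 0
  then obtain u where "u \<in> S" by (metis card.empty not_less_eq_eq ex_in_conv zero_le)
  then show ?case by (intro exI[of _ "{u}"]) (auto simp: vol_def sum_nonneg deg_nonneg)
next
  case (Suc k)
  then obtain T where T: "T \<subseteq> S" "card T = Suc k" "vol T \<ge> 2 * real k" by auto
  have finT: "finite T" using T(1) assms(1) finite_subset by blast
  have "T \<noteq> S" "T \<noteq> {}" using T(2) Suc.prems by auto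
  \<comment> \<open>Both pieces are less dense than \<open>d\<close> while \<open>S\<close> is not,
    so some edge must run between them; its outer end is added to \<open>T\<close>.\<close>
  then have "vol T + vol (S - T) < d * card T + d * card (S - T)"
    using T(1) by (intro add_strict_mono assms(3)) auto
  also have "\<dots> = d * card S"
    using T(1) assms(1) finT by (simp add: card_Diff_subset card_mono distrib_left[symmetric] of_nat_diff)
  finally have "(\<Sum>u\<in>T. deg (S - T) u) > 0"
    using vol_split[OF assms(1) T(1)] assms(2) by linarith
  then obtain u where u: "u \<in> T" "deg (S - T) u > 0"
    by (meson not_le sum_nonpos)
  then obtain w where w: "w \<in> S - T" "adj u w > 0"
    unfolding deg_def by (meson not_le sum_nonpos)
  have "deg T w \<ge> adj w u"
    unfolding deg_def using finT u(1) by (intro member_le_sum) auto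
  then have "deg T w \<ge> 1" using w(2) adj_sym[of w u] by (auto simp: adj_def split: if_splits)
  then have "vol (insert w T) \<ge> 2 * real (Suc k)"
    using vol_insert[OF finT, of w] w(1) T(3) by simp
  moreover have "card (insert w T) = Suc (Suc k)" using w(1) finT T(2) by simp
  ultimately show ?case using w(1) T(1) by (intro exI[of _ "insert w T"]) auto
qed

text \<open>For \<open>d \<ge> 2\<close> this is the ball vector of a minimal dense subset, extended
  by zero; entries are nonnegative, so restoring the other vertices of \<open>V\<close> changes
  neither form. The factor \<open>tree_size s\<close> in the support bound serves the case
  \<open>d < 2\<close>.\<close>

lemma exists_local_vector:
  fixes d \<Delta> :: real
  assumes fin: "finite V" and ne: "V \<noteq> {}" and \<Delta>: "\<And>u. u \<in> V \<Longrightarrow> deg V u \<le> \<Delta>"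
    and d: "d \<ge> 1" "vol V \<ge> d * card V"
  shows "\<exists>W\<subseteq>V. \<exists>x. (\<forall>u. 0 \<le> x u) \<and> (\<forall>u. u \<notin> W \<longrightarrow> x u = 0) \<and>
    real (card W) \<le> real (tree_size s) * (1 + \<Delta>) ^ s \<and> 0 < (\<Sum>u\<in>V. (x u)\<^sup>2) \<and>
    2 * cos (pi / (real s + 2)) * sqrt (d - 1) * (\<Sum>u\<in>V. (x u)\<^sup>2) \<le> quad V x"
proof -
  define c where "c = cos (pi / (real s + 2))"
  have \<Delta>0: "\<Delta> \<ge> 0" using \<Delta> ne deg_nonneg order_trans by blast
  have "pi / (real s + 2) \<le> pi / 2" by (intro divide_left_mono) auto
  moreover have "- (pi / 2) \<le> pi / (real s + 2)" by (rule order_trans[of _ 0]) auto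
  ultimately have c: "0 \<le> c" "c \<le> 1" unfolding c_def using cos_path_less_1[of s]
    by (auto intro: cos_ge_zero)
  obtain S where S: "S \<subseteq> V" "S \<noteq> {}" "vol S \<ge> d * card S"
    and min: "\<And>T. T \<subset> S \<Longrightarrow> T \<noteq> {} \<Longrightarrow> vol T < d * card T"
    using exists_minimal_dense[OF fin ne d(2)] by blast
  have finS: "finite S" using S(1) fin finite_subset by blast
  have pow1: "(1 + \<Delta>) ^ s \<ge> 1" using \<Delta>0 by (intro one_le_power) auto
  show ?thesis
  proof (cases "d \<ge> 2")
    case True
    have deg2: "\<And>u. u \<in> S \<Longrightarrow> deg S u \<ge> 2"
      using minimal_dense_deg[OF finS S(3) True min] by blast
    obtain v x where v: "v \<in> S" and x: "\<And>u. x u \<ge> 0" "\<And>u. u \<notin> nball S s v \<Longrightarrow> x u = 0"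
      "(\<Sum>u\<in>S. (x u)\<^sup>2) > 0" "quad S x \<ge> 2 * c * sqrt (d - 1) * (\<Sum>u\<in>S. (x u)\<^sup>2)"
      using exists_ball_vector[OF finS deg2 S(2) True S(3), of s] unfolding c_def by blast
    have sub: "nball S s v \<subseteq> S" using nball_subset[OF v] .
    have "real (card (nball S s v)) \<le> (1 + \<Delta>) ^ s"
      using card_nball_le[OF finS v] \<Delta> deg_mono[OF fin S(1)] S(1) by (meson order_trans subsetD)
    also have "\<dots> \<le> real (tree_size s) * (1 + \<Delta>) ^ s"
      using mult_right_mono[of 1 "real (tree_size s)" "(1 + \<Delta>) ^ s"] tree_size(1)[of s] pow1 by simp
    finally have card: "real (card (nball S s v)) \<le> real (tree_size s) * (1 + \<Delta>) ^ s" .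
    have x0: "x u = 0" if "u \<notin> S" for u using sub x(2) that by blast
    show ?thesis
      using x card sub S(1) quad_support[OF fin S(1) x0] unfolding c_def
      by (intro exI[of _ "nball S s v"] conjI exI[of _ x]) auto
  next
    case False
    \<comment> \<open>Non-backtracking walks may die at leaves, but here constant vectors already suffice.\<close>
    have "2 * sqrt (d - 1) \<le> d"
    proof -
      have "(2 * sqrt (d - 1))\<^sup>2 \<le> d\<^sup>2"
        using d(1) zero_le_power2[of "d - 2"] by (simp add: power2_eq_square algebra_simps)
      then show ?thesis by (rule power2_le_imp_le) (use d(1) in simp)
    qed
    have sqrt1: "sqrt (d - 1) \<le> 1" "sqrt (d - 1) \<ge> 0" using False d(1) by auto
    \<comment> \<open>If \<open>S\<close> is small, all of it is dense enough because
      \<open>2 sqrt (d - 1) \<le> d\<close>. Otherwise a connected piece with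
      \<open>tree_size s\<close> vertices has average degree at least \<open>2 c\<close>, which
      suffices because \<open>sqrt (d - 1) \<le> 1\<close>.\<close>
    have "\<exists>T\<subseteq>S. T \<noteq> {} \<and> card T \<le> tree_size s \<and> 2 * c * sqrt (d - 1) * card T \<le> vol T"
    proof (cases "card S \<le> tree_size s")
      case True
      have "c * (2 * sqrt (d - 1)) \<le> 1 * d"
        using c \<open>2 * sqrt (d - 1) \<le> d\<close> sqrt1 by (intro mult_mono) auto
      then have "2 * c * sqrt (d - 1) * card S \<le> d * card S"
        by (intro mult_right_mono) (auto simp: algebra_simps)
      then show ?thesis using True S(2,3) by (intro exI[of _ S]) auto
    next
      case False
      define k where "k = tree_size s - 1"
      have k: "tree_size s = Suc k" using tree_size(1)[of s] unfolding k_def by simp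
      obtain T where T: "T \<subseteq> S" "card T = Suc k" "vol T \<ge> 2 * real k"
        using minimal_dense_tree[OF finS S(3) min, of k] False k by auto
      have "2 * c * sqrt (d - 1) * card T \<le> 2 * c * 1 * card T"
        using c sqrt1 by (intro mult_right_mono mult_left_mono) auto
      also have "\<dots> \<le> 2 * real k" using tree_size(2)[of s] T(2) unfolding c_def k by simp
      also have "\<dots> \<le> vol T" by (rule T(3))
      finally show ?thesis using T k by (intro exI[of _ T]) auto
    qed
    then obtain T where T: "T \<subseteq> S" "T \<noteq> {}" "card T \<le> tree_size s"
      "2 * c * sqrt (d - 1) * card T \<le> vol T" by blast
    define x :: "'a \<Rightarrow> real" where "x u = of_bool (u \<in> T)" for u
    have TV: "T \<subseteq> V" using T(1) S(1) by blast
    have finT: "finite T" using TV fin finite_subset by blast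
    have supp: "quad V x = quad T x" "(\<Sum>u\<in>V. (x u)\<^sup>2) = (\<Sum>u\<in>T. (x u)\<^sup>2)"
      using quad_support[OF fin TV, of x] by (auto simp: x_def)
    have "quad T x = vol T" "(\<Sum>u\<in>T. (x u)\<^sup>2) = real (card T)"
      unfolding quad_def vol_def deg_def x_def by auto
    moreover have "real (card T) \<le> real (tree_size s) * (1 + \<Delta>) ^ s"
      using T(3) pow1 by (metis mult_mono mult.right_neutral of_nat_0_le_iff of_nat_mono zero_le_one)
    ultimately show ?thesis
      using T(2,4) TV supp finT unfolding c_def
      by (intro exI[of _ T] conjI exI[of _ x]) (auto simp: x_def card_gt_0_iff)
  qed
qed

end

section \<open>Switching to small degree\<close>

definition dot :: "nat \<Rightarrow> (nat \<Rightarrow> real) \<Rightarrow> (nat \<Rightarrow> real) \<Rightarrow> real" where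
  "dot r x y = (\<Sum>p<r. x p * y p)"

lemma dot_commute: "dot r x y = dot r y x"
  by (simp add: dot_def mult.commute)

lemma gram_psd:
  assumes "finite V"
  shows "0 \<le> (\<Sum>j\<in>V. \<Sum>k\<in>V. c j * c k * dot r (v j) (v k))"
proof -
  have "(\<Sum>j\<in>V. \<Sum>k\<in>V. c j * c k * dot r (v j) (v k))
      = (\<Sum>j\<in>V. \<Sum>k\<in>V. \<Sum>p<r. (c j * v j p) * (c k * v k p))"
    by (simp add: dot_def sum_distrib_left mult_ac)
  also have "\<dots> = (\<Sum>j\<in>V. \<Sum>p<r. \<Sum>k\<in>V. (c j * v j p) * (c k * v k p))"
    by (intro sum.cong refl sum.swap)
  also have "\<dots> = (\<Sum>p<r. \<Sum>j\<in>V. \<Sum>k\<in>V. (c j * v j p) * (c k * v k p))"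
    by (rule sum.swap)
  also have "\<dots> = (\<Sum>p<r. (\<Sum>j\<in>V. c j * v j p)\<^sup>2)"
    by (simp add: power2_eq_square sum_product)
  finally show ?thesis by (simp add: sum_nonneg)
qed

lemma sum_outer_products:
  fixes v :: "'a \<Rightarrow> nat \<Rightarrow> real"
  shows "(\<Sum>p<r. \<Sum>q<r. (\<Sum>k\<in>V. c k * (v k p * v k q)) * (\<Sum>k\<in>V. c k * (v k p * v k q)))
    = (\<Sum>k\<in>V. \<Sum>l\<in>V. c k * c l * (dot r (v k) (v l))\<^sup>2)"
proof -
  have "(\<Sum>p<r. \<Sum>q<r. (\<Sum>k\<in>V. c k * (v k p * v k q)) * (\<Sum>k\<in>V. c k * (v k p * v k q)))
      = (\<Sum>p<r. \<Sum>q<r. \<Sum>k\<in>V. \<Sum>l\<in>V. c k * c l * ((v k p * v l p) * (v k q * v l q)))"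
    by (simp add: sum_product mult_ac)
  also have "\<dots> = (\<Sum>p<r. \<Sum>k\<in>V. \<Sum>q<r. \<Sum>l\<in>V. c k * c l * ((v k p * v l p) * (v k q * v l q)))"
    by (intro sum.cong refl sum.swap)
  also have "\<dots> = (\<Sum>k\<in>V. \<Sum>p<r. \<Sum>q<r. \<Sum>l\<in>V. c k * c l * ((v k p * v l p) * (v k q * v l q)))"
    by (rule sum.swap)
  also have "\<dots> = (\<Sum>k\<in>V. \<Sum>p<r. \<Sum>l\<in>V. \<Sum>q<r. c k * c l * ((v k p * v l p) * (v k q * v l q)))"
    by (intro sum.cong refl sum.swap)
  also have "\<dots> = (\<Sum>k\<in>V. \<Sum>l\<in>V. \<Sum>p<r. \<Sum>q<r. c k * c l * ((v k p * v l p) * (v k q * v l q)))"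
    by (intro sum.cong refl sum.swap)
  also have "\<dots> = (\<Sum>k\<in>V. \<Sum>l\<in>V. c k * c l * (dot r (v k) (v l))\<^sup>2)"
    unfolding dot_def power2_eq_square sum_product by (simp only: sum_distrib_left)
  finally show ?thesis .
qed

lemma sum_outer_product_mixed:
  fixes v :: "'a \<Rightarrow> nat \<Rightarrow> real"
  shows "(\<Sum>p<r. \<Sum>q<r. (x p * y q) * (\<Sum>k\<in>V. c k * (v k p * v k q)))
    = (\<Sum>k\<in>V. c k * (dot r x (v k) * dot r y (v k)))"
proof -
  have "(\<Sum>p<r. \<Sum>q<r. (x p * y q) * (\<Sum>k\<in>V. c k * (v k p * v k q)))
      = (\<Sum>p<r. \<Sum>q<r. \<Sum>k\<in>V. c k * ((x p * v k p) * (y q * v k q)))"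
    by (simp add: sum_distrib_left mult_ac)
  also have "\<dots> = (\<Sum>p<r. \<Sum>k\<in>V. \<Sum>q<r. c k * ((x p * v k p) * (y q * v k q)))"
    by (intro sum.cong refl sum.swap)
  also have "\<dots> = (\<Sum>k\<in>V. \<Sum>p<r. \<Sum>q<r. c k * ((x p * v k p) * (y q * v k q)))"
    by (rule sum.swap)
  also have "\<dots> = (\<Sum>k\<in>V. c k * (dot r x (v k) * dot r y (v k)))"
    unfolding dot_def sum_product by (simp only: sum_distrib_left)
  finally show ?thesis .
qed

text \<open>The squared Frobenius norm of \<open>x y\<^sup>T - \<Sum> c\<^sub>k v\<^sub>k v\<^sub>k\<^sup>T\<close> is nonnegative.\<close>

lemma frobenius_nonneg:
  fixes v :: "'a \<Rightarrow> nat \<Rightarrow> real"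
  shows "0 \<le> dot r x x * dot r y y - 2 * (\<Sum>k\<in>V. c k * (dot r x (v k) * dot r y (v k)))
      + (\<Sum>k\<in>V. \<Sum>l\<in>V. c k * c l * (dot r (v k) (v l))\<^sup>2)"
proof -
  let ?T = "\<lambda>p q. \<Sum>k\<in>V. c k * (v k p * v k q)"
  have id: "(a * b - t)\<^sup>2 = (a * a) * (b * b) - 2 * ((a * b) * t) + t * t" for a b t :: real
    by (simp add: power2_eq_square algebra_simps)
  have "(x p * y q - ?T p q)\<^sup>2 = (x p * x p) * (y q * y q) - 2 * ((x p * y q) * ?T p q) + ?T p q * ?T p q" for p q
    by (rule id)
  then have "(\<Sum>p<r. \<Sum>q<r. (x p * y q - ?T p q)\<^sup>2) = (\<Sum>p<r. \<Sum>q<r. (x p * x p) * (y q * y q))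
      - 2 * (\<Sum>p<r. \<Sum>q<r. (x p * y q) * ?T p q) + (\<Sum>p<r. \<Sum>q<r. ?T p q * ?T p q)"
    by (simp add: sum.distrib sum_subtractf sum_distrib_left)
  moreover have "(\<Sum>p<r. \<Sum>q<r. (x p * x p) * (y q * y q)) = dot r x x * dot r y y"
    by (simp add: dot_def sum_product)
  moreover have "0 \<le> (\<Sum>p<r. \<Sum>q<r. (x p * y q - ?T p q)\<^sup>2)" by (simp add: sum_nonneg)
  ultimately show ?thesis unfolding sum_outer_products sum_outer_product_mixed by simp
qed

text \<open>The Gram matrix and the \<open>r\<close> by \<open>r\<close> matrix of summed outer
  products share trace and Frobenius norm. In the latter only \<open>r\<close> diagonal entries
  enter the trace, so Cauchy-Schwarz applies.\<close>

lemma trace_squared_le: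
  fixes v :: "'a \<Rightarrow> nat \<Rightarrow> real"
  shows "(\<Sum>k\<in>V. dot r (v k) (v k))\<^sup>2 \<le> real r * (\<Sum>k\<in>V. \<Sum>l\<in>V. (dot r (v k) (v l))\<^sup>2)"
proof -
  let ?T = "\<lambda>p q. \<Sum>k\<in>V. 1 * (v k p * v k q)"
  have "(\<Sum>k\<in>V. dot r (v k) (v k)) = (\<Sum>p<r. ?T p p)"
    unfolding dot_def by (subst sum.swap) simp
  then have "(\<Sum>k\<in>V. dot r (v k) (v k))\<^sup>2 = (\<Sum>p<r. 1 * ?T p p)\<^sup>2" by simp
  also have "\<dots> \<le> (\<Sum>p<r. 1\<^sup>2) * (\<Sum>p<r. (?T p p)\<^sup>2)" by (rule Cauchy_Schwarz_ineq_sum)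
  also have "\<dots> \<le> real r * (\<Sum>p<r. \<Sum>q<r. ?T p q * ?T p q)"
  proof -
    have "(?T p p)\<^sup>2 \<le> (\<Sum>q<r. ?T p q * ?T p q)" if "p < r" for p
      using that member_le_sum[of p "{..<r}" "\<lambda>q. ?T p q * ?T p q"] by (simp add: power2_eq_square)
    then show ?thesis by (auto intro!: mult_left_mono sum_mono)
  qed
  finally show ?thesis unfolding sum_outer_products by simp
qed

text \<open>The index type is arbitrary so that a set of lines can index its own unit
  vectors.\<close>

definition equi_vecs :: "nat \<Rightarrow> real \<Rightarrow> 'a set \<Rightarrow> ('a \<Rightarrow> nat \<Rightarrow> real) \<Rightarrow> bool" where
  "equi_vecs r \<alpha> V v \<longleftrightarrow> finite V \<and> (\<forall>i\<in>V. dot r (v i) (v i) = 1) \<and>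
     (\<forall>i\<in>V. \<forall>j\<in>V. i \<noteq> j \<longrightarrow> \<bar>dot r (v i) (v j)\<bar> = \<alpha>)"

definition switch :: "('a \<Rightarrow> real) \<Rightarrow> ('a \<Rightarrow> nat \<Rightarrow> real) \<Rightarrow> 'a \<Rightarrow> nat \<Rightarrow> real" where
  "switch \<sigma> v k p = \<sigma> k * v k p"

lemma dot_switch: "dot r (switch \<sigma> v j) (switch \<sigma> v k) = \<sigma> j * \<sigma> k * dot r (v j) (v k)"
  by (simp add: dot_def switch_def sum_distrib_left mult_ac)

lemma equi_vecs_switch:
  assumes "equi_vecs r \<alpha> V v" "\<And>k. \<bar>\<sigma> k\<bar> = 1"
  shows "equi_vecs r \<alpha> V (switch \<sigma> v)"
proof -
  have "\<sigma> k * \<sigma> k = 1" for k using assms(2)[of k] abs_mult_self_eq[of "\<sigma> k"] by simp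
  then show ?thesis using assms unfolding equi_vecs_def dot_switch abs_mult by simp
qed

text \<open>Distinct outer products \<open>v v^T\<close> have inner product exactly
  \<open>\<alpha>^2\<close>, whatever the signs. Coefficients \<open>\<alpha>^2\<close> on
  \<open>P\<close> and \<open>- \<alpha>^2\<close> on \<open>N\<close> sum to zero, which removes
  this common part; both the mixed term and the sum of squared coefficients are
  \<open>2 m \<alpha>^4\<close>, and nonnegativity of the Frobenius norm forces this to be at most
  1.\<close>

lemma balanced_sign_bound:
  fixes v :: "'a \<Rightarrow> nat \<Rightarrow> real"
  assumes eq: "equi_vecs r \<alpha> V v" and \<alpha>: "0 < \<alpha>" "\<alpha> < 1"
    and ij: "i \<in> V" "j \<in> V" and P: "P \<subseteq> V" and N: "N \<subseteq> V" and PN: "P \<inter> N = {}" and m: "card P = m" "card N = m"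
    and pos: "\<And>k. k \<in> P \<Longrightarrow> dot r (v i) (v k) * dot r (v j) (v k) = \<alpha>\<^sup>2"
    and neg: "\<And>k. k \<in> N \<Longrightarrow> dot r (v i) (v k) * dot r (v j) (v k) = - \<alpha>\<^sup>2"
  shows "real m \<le> 1 / (2 * \<alpha> ^ 4)"
proof -
  define c where "c k = (if k \<in> P then \<alpha>\<^sup>2 else - \<alpha>\<^sup>2)" for k
  let ?U = "P \<union> N"
  have fin: "finite P" "finite N" using P N eq finite_subset unfolding equi_vecs_def by auto
  have split: "(\<Sum>k\<in>?U. f k) = (\<Sum>k\<in>P. f k) + (\<Sum>k\<in>N. f k)" for f :: "'a \<Rightarrow> real"
    by (rule sum.union_disjoint[OF fin PN])
  have cN: "c k = - \<alpha>\<^sup>2" if "k \<in> N" for k using that PN unfolding c_def by auto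
  have cP: "c k = \<alpha>\<^sup>2" if "k \<in> P" for k using that unfolding c_def by auto
  have sum0: "(\<Sum>k\<in>?U. c k) = 0" unfolding split using m by (simp add: cN cP)
  have sum2: "(\<Sum>k\<in>?U. (c k)\<^sup>2) = 2 * real m * \<alpha> ^ 4"
    unfolding split using m by (simp add: cN cP power_mult[symmetric])
  have mixed: "(\<Sum>k\<in>?U. c k * (dot r (v i) (v k) * dot r (v j) (v k))) = 2 * real m * \<alpha> ^ 4"
    unfolding split using m by (simp add: cN cP pos neg power2_eq_square power4_eq_xxxx)
  have "(dot r (v k) (v l))\<^sup>2 = \<alpha>\<^sup>2 + (if l = k then 1 - \<alpha>\<^sup>2 else 0)" if "k \<in> V" "l \<in> V" for k l
  proof (cases "l = k")
    case True
    then show ?thesis using eq that unfolding equi_vecs_def by simp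
  next
    case False
    then have "\<bar>dot r (v k) (v l)\<bar> = \<alpha>" using eq that unfolding equi_vecs_def by metis
    then show ?thesis using False power2_abs[of "dot r (v k) (v l)"] by simp
  qed
  then have "(\<Sum>k\<in>?U. \<Sum>l\<in>?U. c k * c l * (dot r (v k) (v l))\<^sup>2)
      = (\<Sum>k\<in>?U. \<Sum>l\<in>?U. \<alpha>\<^sup>2 * (c k * c l) + (if l = k then c k * c l * (1 - \<alpha>\<^sup>2) else 0))"
    using P N by (intro sum.cong refl) (auto simp: algebra_simps subset_iff)
  also have "\<dots> = \<alpha>\<^sup>2 * ((\<Sum>k\<in>?U. c k) * (\<Sum>l\<in>?U. c l)) + (1 - \<alpha>\<^sup>2) * (\<Sum>k\<in>?U. (c k)\<^sup>2)"
    using fin by (simp add: sum.distrib sum_product sum_distrib_left power2_eq_square mult.commute)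
  finally have quad: "(\<Sum>k\<in>?U. \<Sum>l\<in>?U. c k * c l * (dot r (v k) (v l))\<^sup>2) = (1 - \<alpha>\<^sup>2) * (2 * real m * \<alpha> ^ 4)"
    unfolding sum0 sum2 by simp
  have "dot r (v i) (v i) = 1" "dot r (v j) (v j) = 1" using eq ij unfolding equi_vecs_def by auto
  then have "0 \<le> 1 - 2 * (2 * real m * \<alpha> ^ 4) + (1 - \<alpha>\<^sup>2) * (2 * real m * \<alpha> ^ 4)"
    using frobenius_nonneg[of r "v i" "v j" c v ?U] unfolding mixed quad by simp
  moreover have "(1 - \<alpha>\<^sup>2) * (2 * real m * \<alpha> ^ 4) \<le> 1 * (2 * real m * \<alpha> ^ 4)"
    by (intro mult_right_mono) auto
  ultimately have "2 * real m * \<alpha> ^ 4 \<le> 1" by linarith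
  then show ?thesis using \<alpha> by (simp add: field_simps)
qed

lemma sign_bound:
  fixes v :: "'a \<Rightarrow> nat \<Rightarrow> real"
  assumes eq: "equi_vecs r \<alpha> V v" and \<alpha>: "0 < \<alpha>" "\<alpha> < 1"
    and ij: "i \<in> V" "j \<in> V" and P: "P \<subseteq> V" and N: "N \<subseteq> V" and PN: "P \<inter> N = {}"
    and pos: "\<And>k. k \<in> P \<Longrightarrow> dot r (v i) (v k) * dot r (v j) (v k) = \<alpha>\<^sup>2"
    and neg: "\<And>k. k \<in> N \<Longrightarrow> dot r (v i) (v k) * dot r (v j) (v k) = - \<alpha>\<^sup>2"
  shows "real (card P) \<le> 1 / (2 * \<alpha> ^ 4) \<or> real (card N) \<le> 1 / (2 * \<alpha> ^ 4)"
proof -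
  define m where "m = min (card P) (card N)"
  obtain P' where P': "P' \<subseteq> P" "card P' = m" using obtain_subset_with_card_n[of m P] unfolding m_def by auto
  obtain N' where N': "N' \<subseteq> N" "card N' = m" using obtain_subset_with_card_n[of m N] unfolding m_def by auto
  have "real m \<le> 1 / (2 * \<alpha> ^ 4)"
    using P'(1) N'(1) P N PN pos neg
    by (intro balanced_sign_bound[OF eq \<alpha> ij _ _ _ P'(2) N'(2)]) blast+
  then show ?thesis unfolding m_def by (auto simp: min_def split: if_splits)
qed

lemma switch_positive_row:
  assumes "equi_vecs r \<alpha> V v" "z \<in> V" "\<alpha> > 0"
  obtains v' where "equi_vecs r \<alpha> V v'" "\<And>k. k \<in> V \<Longrightarrow> k \<noteq> z \<Longrightarrow> dot r (v' z) (v' k) = \<alpha>"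
proof -
  define \<sigma> where "\<sigma> k = (if k \<noteq> z \<and> dot r (v z) (v k) < 0 then - 1 else 1 :: real)" for k
  have "equi_vecs r \<alpha> V (switch \<sigma> v)" using assms(1) by (rule equi_vecs_switch) (simp add: \<sigma>_def)
  moreover have "dot r (switch \<sigma> v z) (switch \<sigma> v k) = \<alpha>" if "k \<in> V" "k \<noteq> z" for k
  proof -
    have "\<bar>dot r (v z) (v k)\<bar> = \<alpha>" using assms that unfolding equi_vecs_def by metis
    then show ?thesis using that(2) unfolding dot_switch \<sigma>_def by auto
  qed
  ultimately show ?thesis using that by blast
qed

text \<open>Once row \<open>z\<close> is positive, its product with row \<open>j\<close> shows the
  signs of row \<open>j\<close>, so \<open>sign_bound\<close> makes either the positive or the
  negative entries of each row few.\<close>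

lemma switch_small_degree:
  fixes v :: "'a \<Rightarrow> nat \<Rightarrow> real"
  assumes eq0: "equi_vecs r \<alpha> V v" and \<alpha>: "0 < \<alpha>" "\<alpha> < 1"
  obtains v' where "equi_vecs r \<alpha> V v'"
    "\<And>j. j \<in> V \<Longrightarrow> real (card {k\<in>V. j \<noteq> k \<and> dot r (v' j) (v' k) < 0}) \<le> 5 / \<alpha> ^ 4"
proof (cases "V = {}")
  case True
  then show ?thesis using that[OF eq0] by simp
next
  case False
  then obtain z where z: "z \<in> V" by blast
  obtain w where eq: "equi_vecs r \<alpha> V w" and wz: "\<And>k. k \<in> V \<Longrightarrow> k \<noteq> z \<Longrightarrow> dot r (w z) (w k) = \<alpha>"
    using switch_positive_row[OF eq0 z \<alpha>(1)] by blast
  have fin: "finite V" using eq unfolding equi_vecs_def by simp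
  \<comment> \<open>The rows in \<open>F\<close> are almost entirely negative; by positive semidefiniteness \<open>F\<close> is small,
    so flipping \<open>F\<close> makes every row almost entirely positive.\<close>
  define K where "K = 1 / (2 * \<alpha> ^ 4)"
  define P where "P j = {k\<in>V. k \<noteq> z \<and> k \<noteq> j \<and> dot r (w j) (w k) > 0}" for j
  define N where "N j = {k\<in>V. k \<noteq> z \<and> k \<noteq> j \<and> dot r (w j) (w k) < 0}" for j
  define F where "F = {j\<in>V. j \<noteq> z \<and> real (card (N j)) > K}"
  have finPNF: "finite (P j)" "finite (N j)" "finite F" for j
    using fin unfolding P_def N_def F_def by auto
  have absV: "\<bar>dot r (w j) (w k)\<bar> = \<alpha>" if "j \<in> V" "k \<in> V" "k \<noteq> j" for j k
    using that eq unfolding equi_vecs_def by metis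
  have dotP: "dot r (w j) (w k) = \<alpha>" if "j \<in> V" "k \<in> P j" for j k
    using absV[of j k] that unfolding P_def by simp
  have dotN: "dot r (w j) (w k) = - \<alpha>" if "j \<in> V" "k \<in> V" "k \<noteq> z" "k \<noteq> j" "k \<notin> P j" for j k
    using absV[of j k] that unfolding P_def by simp
  have PK: "real (card (P j)) \<le> K" if "j \<in> F" for j
  proof -
    have j: "j \<in> V" "j \<noteq> z" "\<not> real (card (N j)) \<le> K" using that unfolding F_def by auto
    have "real (card (P j)) \<le> 1 / (2 * \<alpha> ^ 4) \<or> real (card (N j)) \<le> 1 / (2 * \<alpha> ^ 4)"
    proof (rule sign_bound[OF eq \<alpha> z j(1)])
      show "P j \<subseteq> V" "N j \<subseteq> V" "P j \<inter> N j = {}" unfolding P_def N_def by auto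
      show "dot r (w z) (w k) * dot r (w j) (w k) = \<alpha>\<^sup>2" if "k \<in> P j" for k
        using wz[of k] that dotP[OF j(1) that] unfolding P_def by (simp add: power2_eq_square)
      show "dot r (w z) (w k) * dot r (w j) (w k) = - \<alpha>\<^sup>2" if "k \<in> N j" for k
      proof -
        have "dot r (w j) (w k) = - \<alpha>" using that by (intro dotN j(1)) (auto simp: N_def P_def)
        then show ?thesis using wz[of k] that unfolding N_def by (simp add: power2_eq_square)
      qed
    qed
    then show ?thesis using j unfolding K_def by simp
  qed
  \<comment> \<open>Within \<open>F\<close> all but few entries are \<open>- \<alpha>\<close>, yet
    the sum of all entries over \<open>F\<close> is a squared norm. A large \<open>F\<close> would
    make it negative.\<close>
  have row: "(\<Sum>k\<in>F. 1 * 1 * dot r (w j) (w k)) \<le> 1 + \<alpha> + 2 * \<alpha> * K - \<alpha> * card F" if j: "j \<in> F" for j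
  proof -
    have jV: "j \<in> V" using j unfolding F_def by simp
    have "(\<Sum>k\<in>F. dot r (w j) (w k)) = dot r (w j) (w j) + (\<Sum>k\<in>F - {j}. dot r (w j) (w k))"
      by (rule sum.remove[OF finPNF(3) j])
    also have "(\<Sum>k\<in>F - {j}. dot r (w j) (w k)) = (\<Sum>k\<in>F - {j}. - \<alpha> + 2 * \<alpha> * of_bool (k \<in> P j))"
    proof (intro sum.cong refl)
      fix k assume k: "k \<in> F - {j}"
      then have "k \<in> V" "k \<noteq> z" "k \<noteq> j" unfolding F_def by auto
      then show "dot r (w j) (w k) = - \<alpha> + 2 * \<alpha> * of_bool (k \<in> P j)"
        using dotP[OF jV] dotN[OF jV] by (cases "k \<in> P j") auto
    qed
    also have "\<dots> = - \<alpha> * (real (card F) - 1) + 2 * \<alpha> * (\<Sum>k\<in>F - {j}. of_bool (k \<in> P j))"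
    proof -
      have "real (card (F - {j})) = real (card F) - 1"
        using card_Suc_Diff1[OF finPNF(3) j] by linarith
      then show ?thesis unfolding sum.distrib sum_distrib_left[symmetric] sum_constant by simp
    qed
    also have "(\<Sum>k\<in>F - {j}. of_bool (k \<in> P j) :: real) \<le> K"
    proof -
      have "(\<Sum>k\<in>F - {j}. of_bool (k \<in> P j) :: real) = real (card ((F - {j}) \<inter> P j))"
        using finPNF(3) by (simp add: of_bool_def sum.If_cases)
      also have "\<dots> \<le> real (card (P j))" using finPNF(1) by (simp add: card_mono)
      finally show ?thesis using PK[OF j] by simp
    qed
    finally show ?thesis using eq jV \<alpha> unfolding equi_vecs_def by (simp add: algebra_simps)
  qed
  have "0 \<le> (\<Sum>j\<in>F. \<Sum>k\<in>F. 1 * 1 * dot r (w j) (w k))"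
    using gram_psd[OF finPNF(3), of "\<lambda>_. 1"] by simp
  also have "\<dots> \<le> (\<Sum>j\<in>F. 1 + \<alpha> + 2 * \<alpha> * K - \<alpha> * card F)" by (intro sum_mono row)
  also have "\<dots> = real (card F) * (1 + \<alpha> + 2 * \<alpha> * K - \<alpha> * card F)" by simp
  finally have "0 \<le> real (card F) * (1 + \<alpha> + 2 * \<alpha> * K - \<alpha> * card F)" .
  moreover have K0: "K \<ge> 0" unfolding K_def using \<alpha> by simp
  ultimately have "\<alpha> * card F \<le> 1 + \<alpha> + 2 * \<alpha> * K"
    using \<alpha> by (cases "card F = 0") (auto simp: zero_le_mult_iff)
  then have F: "card F \<le> 1 / \<alpha> + 1 + 2 * K" using \<alpha> by (simp add: field_simps)
  define \<sigma> where "\<sigma> k = (if k \<in> F then - 1 else 1 :: real)" for k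
  \<comment> \<open>The left side is at most \<open>3 K + 2 + 1 / \<alpha>\<close>, that is, at most
    4.5 times \<open>1 / \<alpha>^4\<close>.\<close>
  have total: "K + 1 + card F \<le> 5 / \<alpha> ^ 4"
  proof -
    have "\<alpha> ^ 4 \<le> \<alpha> ^ 1" "\<alpha> ^ 4 \<le> 1" using \<alpha> by (intro power_decreasing power_le_one; simp)+
    then have "1 / \<alpha> \<le> 1 / \<alpha> ^ 4" "1 \<le> 1 / \<alpha> ^ 4" using \<alpha> by (auto simp: field_simps)
    moreover have "K = (1 / 2) * (1 / \<alpha> ^ 4)" unfolding K_def by simp
    moreover have "5 / \<alpha> ^ 4 = 5 * (1 / \<alpha> ^ 4)" by simp
    ultimately show ?thesis using F by linarith
  qed
  show ?thesis
  proof (rule that)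
    show "equi_vecs r \<alpha> V (switch \<sigma> w)" using eq by (rule equi_vecs_switch) (simp add: \<sigma>_def)
    fix j assume j: "j \<in> V"
    let ?D = "{k\<in>V. j \<noteq> k \<and> dot r (switch \<sigma> w j) (switch \<sigma> w k) < 0}"
    have zF: "z \<notin> F" unfolding F_def by simp
    have bound: "real (card ?D) \<le> card A + 1 + card F" if "?D \<subseteq> A \<union> {z} \<union> F" "finite A" for A
    proof -
      have "card ?D \<le> card (A \<union> {z} \<union> F)" using that finPNF(3) by (intro card_mono) auto
      also have "\<dots> \<le> card A + 1 + card F"
        by (intro order_trans[OF card_Un_le] add_mono order.refl) simp
      finally show ?thesis by linarith
    qed
    show "real (card ?D) \<le> 5 / \<alpha> ^ 4"
    proof (cases "j \<in> F")
      case True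
      \<comment> \<open>Outside \<open>F\<close> the signs of row \<open>j\<close> are reversed, so
        new negative entries come from \<open>P j\<close>; indices in \<open>F\<close> and
        \<open>z\<close> are simply counted in full.\<close>
      have "?D \<subseteq> P j \<union> {z} \<union> F"
        using True unfolding dot_switch \<sigma>_def P_def by auto
      then show ?thesis using bound[of "P j"] PK[OF True] finPNF(1) total by simp
    next
      case False
      show ?thesis
      proof (cases "j = z")
        case True
        have "?D \<subseteq> {} \<union> {z} \<union> F"
          using True zF wz \<alpha> unfolding dot_switch \<sigma>_def by (auto split: if_splits)
        then show ?thesis using bound[of "{}"] K0 total by simp
      next
        case jz: False
        have "?D \<subseteq> N j \<union> {z} \<union> F"
          using False unfolding dot_switch \<sigma>_def N_def by (auto split: if_splits)
        moreover have "real (card (N j)) \<le> K" using False jz j unfolding F_def by simp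
        ultimately show ?thesis using bound[of "N j"] finPNF(2) total by simp
      qed
    qed
  qed
qed

section \<open>The graph of negative inner products\<close>

lemma sum_centered_squares_le:
  fixes a :: "'a \<Rightarrow> real"
  assumes "finite V" "V \<noteq> {}"
  shows "(\<Sum>j\<in>V. (a j - (\<Sum>l\<in>V. a l) / card V)\<^sup>2) \<le> (\<Sum>j\<in>V. (a j)\<^sup>2)"
proof -
  define t where "t = (\<Sum>l\<in>V. a l)"
  define n where "n = real (card V)"
  have n: "n > 0" using assms unfolding n_def by (simp add: card_gt_0_iff)
  have "(\<Sum>j\<in>V. (a j - t / n)\<^sup>2) = (\<Sum>j\<in>V. (a j)\<^sup>2 - 2 * (t / n) * a j + (t / n)\<^sup>2)"
    by (intro sum.cong refl) (simp add: power2_diff)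
  also have "\<dots> = (\<Sum>j\<in>V. (a j)\<^sup>2) - 2 * (t / n) * t + n * (t / n)\<^sup>2"
    unfolding sum.distrib sum_subtractf sum_distrib_left[symmetric] t_def[symmetric]
    by (simp add: n_def)
  also have "\<dots> = (\<Sum>j\<in>V. (a j)\<^sup>2) - t\<^sup>2 / n"
    using n by (simp add: field_simps power2_eq_square)
  also have "\<dots> \<le> (\<Sum>j\<in>V. (a j)\<^sup>2)" using n by simp
  finally show ?thesis unfolding t_def n_def .
qed

locale equi_graph =
  fixes r :: nat and \<alpha> :: real and V :: "'a set" and v :: "'a \<Rightarrow> nat \<Rightarrow> real"
  assumes eq: "equi_vecs r \<alpha> V v" and \<alpha>0: "0 < \<alpha>" and \<alpha>1: "\<alpha> < 1" and V_ne: "V \<noteq> {}"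
begin

sublocale graph "\<lambda>j k. j \<noteq> k \<and> dot r (v j) (v k) < 0"
  by unfold_locales (auto simp: dot_commute)

text \<open>Divided by \<open>2 \<alpha>\<close>, the Gram matrix is
  \<open>lam I - A + J / 2\<close> with \<open>A\<close> the adjacency matrix and \<open>J\<close>
  all ones. So \<open>lam\<close> bounds \<open>A\<close> on vectors with sum zero.\<close>

definition lam :: real where "lam = (1 - \<alpha>) / (2 * \<alpha>)"

definition n :: real where "n = real (card V)"

lemma fin: "finite V" using eq unfolding equi_vecs_def by simp

lemma n_ge_1: "n \<ge> 1" unfolding n_def using fin V_ne by (simp add: Suc_leI card_gt_0_iff)

lemma lam_pos: "lam > 0" unfolding lam_def using \<alpha>0 \<alpha>1 by simp

lemma lam_\<alpha>: "1 - \<alpha> = 2 * \<alpha> * lam" unfolding lam_def using \<alpha>0 by simp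

lemma dot_eq:
  assumes "j \<in> V" "k \<in> V"
  shows "dot r (v j) (v k) = \<alpha> + (if k = j then 1 - \<alpha> else 0) - 2 * \<alpha> * adj j k"
proof (cases "k = j")
  case True
  then show ?thesis using eq assms unfolding equi_vecs_def by (simp add: adj_def)
next
  case False
  then have "\<bar>dot r (v j) (v k)\<bar> = \<alpha>" using eq assms unfolding equi_vecs_def by metis
  then show ?thesis using False \<alpha>0 by (auto simp: adj_def)
qed

lemma quad_le_centered:
  assumes "(\<Sum>u\<in>V. y u) = 0"
  shows "quad V y \<le> lam * (\<Sum>u\<in>V. (y u)\<^sup>2)"
proof -
  have "0 \<le> (\<Sum>j\<in>V. \<Sum>k\<in>V. y j * y k * dot r (v j) (v k))" by (rule gram_psd[OF fin])
  also have "\<dots> = (\<Sum>j\<in>V. \<Sum>k\<in>V. \<alpha> * (y j * y k) + (if k = j then (1 - \<alpha>) * (y j * y k) else 0)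
       - 2 * \<alpha> * (adj j k * (y j * y k)))"
    by (intro sum.cong refl) (simp add: dot_eq algebra_simps)
  also have "\<dots> = \<alpha> * ((\<Sum>j\<in>V. y j) * (\<Sum>k\<in>V. y k)) + (1 - \<alpha>) * (\<Sum>u\<in>V. (y u)\<^sup>2) - 2 * \<alpha> * quad V y"
    unfolding quad_def sum_product using fin
    by (simp add: sum.distrib sum_subtractf sum_distrib_left[symmetric] power2_eq_square)
  also have "\<dots> = 2 * \<alpha> * (lam * (\<Sum>u\<in>V. (y u)\<^sup>2) - quad V y)"
    unfolding assms lam_\<alpha> by (simp add: algebra_simps)
  finally show ?thesis using \<alpha>0 by (simp add: zero_le_mult_iff)
qed

text \<open>The vector is centred by subtracting its mean \<open>c\<close>. The quadratic form
  changes by at most \<open>2 c \<Delta> t\<close> with \<open>t\<close> the entry sum, and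
  Cauchy-Schwarz on the support bounds \<open>t^2\<close> by \<open>card W\<close> times the squared
  norm.\<close>

lemma quad_le:
  assumes W: "W \<subseteq> V" and x: "\<And>u. 0 \<le> x u" "\<And>u. u \<notin> W \<Longrightarrow> x u = 0"
    and \<Delta>: "\<And>u. u \<in> V \<Longrightarrow> deg V u \<le> \<Delta>"
  shows "quad V x \<le> (lam + 2 * \<Delta> * card W / n) * (\<Sum>u\<in>V. (x u)\<^sup>2)"
proof -
  define t where "t = (\<Sum>u\<in>V. x u)"
  define c where "c = t / n"
  define y where "y u = x u - c" for u
  have n0: "n > 0" using n_ge_1 by simp
  have t0: "t \<ge> 0" unfolding t_def by (simp add: x sum_nonneg)
  have c0: "c \<ge> 0" unfolding c_def using t0 n0 by simp
  have \<Delta>0: "\<Delta> \<ge> 0" using V_ne \<Delta> deg_nonneg order_trans by blast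
  have y0: "(\<Sum>u\<in>V. y u) = 0" unfolding y_def c_def using n0 by (simp add: sum_subtractf t_def n_def)
  have "quad V y = (\<Sum>j\<in>V. \<Sum>k\<in>V. adj j k * (x j * x k) - c * (adj j k * x j) - c * (adj k j * x k) + c\<^sup>2 * adj j k)"
    unfolding quad_def y_def by (intro sum.cong refl) (simp add: algebra_simps adj_sym power2_eq_square)
  also have "\<dots> = quad V x - c * (\<Sum>j\<in>V. \<Sum>k\<in>V. adj j k * x j) - c * (\<Sum>j\<in>V. \<Sum>k\<in>V. adj k j * x k) + c\<^sup>2 * vol V"
    unfolding quad_def vol_def deg_def by (simp add: sum.distrib sum_subtractf sum_distrib_left)
  also have "(\<Sum>j\<in>V. \<Sum>k\<in>V. adj k j * x k) = (\<Sum>j\<in>V. \<Sum>k\<in>V. adj j k * x j)"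
    by (rule sum.swap)
  also have "(\<Sum>j\<in>V. \<Sum>k\<in>V. adj j k * x j) = (\<Sum>j\<in>V. deg V j * x j)"
    by (simp add: deg_def sum_distrib_right)
  finally have qy: "quad V x = quad V y + 2 * c * (\<Sum>j\<in>V. deg V j * x j) - c\<^sup>2 * vol V" by simp
  have "(\<Sum>j\<in>V. deg V j * x j) \<le> (\<Sum>j\<in>V. \<Delta> * x j)"
    by (intro sum_mono mult_right_mono \<Delta> x)
  then have "2 * c * (\<Sum>j\<in>V. deg V j * x j) \<le> 2 * c * (\<Delta> * t)"
    using c0 unfolding t_def sum_distrib_left[symmetric] by (intro mult_left_mono) auto
  moreover have "c\<^sup>2 * vol V \<ge> 0" by (simp add: vol_def sum_nonneg deg_nonneg)
  moreover have "quad V y \<le> lam * (\<Sum>u\<in>V. (x u)\<^sup>2)"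
  proof -
    have "(\<Sum>u\<in>V. (y u)\<^sup>2) \<le> (\<Sum>u\<in>V. (x u)\<^sup>2)"
      using sum_centered_squares_le[OF fin V_ne, of x] unfolding y_def c_def t_def n_def .
    then show ?thesis using quad_le_centered[OF y0] lam_pos by (meson mult_left_mono order_trans less_imp_le)
  qed
  moreover have "2 * c * (\<Delta> * t) \<le> 2 * \<Delta> * card W / n * (\<Sum>u\<in>V. (x u)\<^sup>2)"
  proof -
    have "t = (\<Sum>u\<in>W. x u)" "(\<Sum>u\<in>V. (x u)\<^sup>2) = (\<Sum>u\<in>W. (x u)\<^sup>2)"
      unfolding t_def using W x(2) fin by (auto intro!: sum.mono_neutral_right)
    then have "t\<^sup>2 \<le> (\<Sum>u\<in>V. (x u)\<^sup>2) * card W"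
      using sum_squared_le_sum_of_squares[of x W] by simp
    then have "(2 * \<Delta> / n) * t\<^sup>2 \<le> (2 * \<Delta> / n) * ((\<Sum>u\<in>V. (x u)\<^sup>2) * card W)"
      using \<Delta>0 n0 by (intro mult_left_mono) auto
    then show ?thesis unfolding c_def by (simp add: power2_eq_square mult_ac)
  qed
  ultimately show ?thesis unfolding qy distrib_right by linarith
qed

text \<open>The test vector is the top eigenvector of a star, with value \<open>sqrt D\<close> at
  the centre and 1 at the leaves; edges between leaves only increase the form. \<open>D\<close> may
  be below the degree, which keeps the support small.\<close>

lemma star_bound:
  assumes \<Delta>: "\<And>u. u \<in> V \<Longrightarrow> deg V u \<le> \<Delta>"
    and u: "u \<in> V" and D: "real D \<le> deg V u" "D > 0"
  shows "sqrt D \<le> lam + 2 * \<Delta> * (real D + 1) / n"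
proof -
  let ?Q = "{k\<in>V. u \<noteq> k \<and> dot r (v u) (v k) < 0}"
  have "D \<le> card ?Q" using D(1) unfolding deg_card[OF fin] by simp
  from obtain_subset_with_card_n[OF this] obtain N where N: "N \<subseteq> ?Q" "card N = D" by metis
  have finN: "finite N" by (rule finite_subset[OF N(1)]) (simp add: fin)
  have uN: "u \<notin> N" using N(1) by auto
  have NV: "N \<subseteq> V" using N(1) by auto
  have adjN: "adj u k = 1" "adj k u = 1" if "k \<in> N" for k
    using that N(1) adj_sym[of k u] unfolding adj_def by auto
  define x where "x k = (if k = u then sqrt D else of_bool (k \<in> N))" for k
  have x0: "x k \<ge> 0" for k unfolding x_def by simp
  let ?W = "insert u N"
  have W: "?W \<subseteq> V" using u NV by auto
  have xW: "x k = 0" if "k \<notin> ?W" for k using that unfolding x_def by auto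
  have cardW: "real (card ?W) = real D + 1" using finN uN N(2) by simp
  have xk: "x k = 1" if "k \<in> N" for k using that uN unfolding x_def by auto
  have sq: "(\<Sum>k\<in>V. (x k)\<^sup>2) = 2 * real D"
  proof -
    have "(\<Sum>k\<in>V. (x k)\<^sup>2) = (\<Sum>k\<in>?W. (x k)\<^sup>2)" by (rule quad_support(2)[OF fin W xW])
    also have "\<dots> = 2 * real D" using finN uN xk N(2) by (simp add: x_def)
    finally show ?thesis .
  qed
  have "quad V x = quad ?W x" by (rule quad_support(1)[OF fin W xW])
  also have "\<dots> = (\<Sum>j\<in>?W. \<Sum>k\<in>?W. adj j k * (x j * x k))" by (rule quad_def)
  also have "\<dots> = (\<Sum>k\<in>?W. adj u k * (x u * x k)) + (\<Sum>j\<in>N. \<Sum>k\<in>?W. adj j k * (x j * x k))"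
    using finN uN by simp
  also have "\<dots> \<ge> sqrt D * D + (\<Sum>j\<in>N. sqrt D)"
  proof (intro add_mono sum_mono)
    have "(\<Sum>k\<in>?W. adj u k * (x u * x k)) = (\<Sum>k\<in>N. sqrt D)"
      using finN uN xk adjN by (simp add: x_def)
    then show "sqrt D * D \<le> (\<Sum>k\<in>?W. adj u k * (x u * x k))" using N(2) by simp
    fix j assume j: "j \<in> N"
    have "adj j u * (x j * x u) \<le> (\<Sum>k\<in>?W. adj j k * (x j * x k))"
      using finN x0 by (intro member_le_sum) auto
    then show "sqrt D \<le> (\<Sum>k\<in>?W. adj j k * (x j * x k))"
      using adjN[OF j] xk[OF j] by (simp add: x_def)
  qed
  also have "sqrt D * D + (\<Sum>j\<in>N. sqrt D) = sqrt D * (2 * real D)" using N(2) by simp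
  finally have "sqrt D * (2 * real D) \<le> quad V x" .
  also have "\<dots> \<le> (lam + 2 * \<Delta> * (real D + 1) / n) * (2 * real D)"
    using quad_le[of ?W x \<Delta>, OF W x0 xW \<Delta>] unfolding cardW sq .
  finally show ?thesis using D(2) by simp
qed

text \<open>Apply the inequality between trace and Frobenius norm to the vectors centred at their mean:
  this removes the all-ones part of the Gram matrix.\<close>

lemma trace_bound: "(n - 1)\<^sup>2 * lam\<^sup>2 \<le> real r * (n * lam\<^sup>2 + vol V)"
proof -
  have n0: "n > 0" using n_ge_1 by simp
  define w where "w k p = v k p - (\<Sum>l\<in>V. v l p) / n" for k p
  have dot_vw: "dot r x (w k) = dot r x (v k) - (\<Sum>l\<in>V. dot r x (v l)) / n" for x k
  proof -
    have "dot r x (w k) = (\<Sum>p<r. x p * v k p - (\<Sum>l\<in>V. x p * v l p) / n)"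
      unfolding dot_def w_def by (intro sum.cong refl) (simp add: right_diff_distrib sum_distrib_left)
    also have "\<dots> = dot r x (v k) - (\<Sum>p<r. \<Sum>l\<in>V. x p * v l p) / n"
      unfolding dot_def by (simp add: sum_subtractf sum_divide_distrib)
    also have "(\<Sum>p<r. \<Sum>l\<in>V. x p * v l p) = (\<Sum>l\<in>V. dot r x (v l))"
      unfolding dot_def by (rule sum.swap)
    finally show ?thesis .
  qed
  define a where "a j k = (if k = j then 1 - \<alpha> else 0) - 2 * \<alpha> * adj j k" for j k
  have dotva: "dot r (v j) (v k) = \<alpha> + a j k" if "j \<in> V" "k \<in> V" for j k
    using dot_eq[OF that] unfolding a_def by simp
  have dot_vw': "dot r (v j) (w k) = a j k - (\<Sum>l\<in>V. a j l) / n" if "j \<in> V" "k \<in> V" for j k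
  proof -
    have "(\<Sum>l\<in>V. dot r (v j) (v l)) = n * \<alpha> + (\<Sum>l\<in>V. a j l)"
      using that(1) by (simp add: dotva sum.distrib n_def)
    then show ?thesis unfolding dot_vw dotva[OF that] using n0 by (simp add: field_simps)
  qed
  have dot_ww: "dot r (w j) (w k) = dot r (v j) (w k) - (\<Sum>l\<in>V. dot r (v l) (w k)) / n" for j k
    using dot_vw[of "w k" j] by (simp add: dot_commute)
  have "(\<Sum>j\<in>V. \<Sum>k\<in>V. (dot r (w j) (w k))\<^sup>2) = (\<Sum>k\<in>V. \<Sum>j\<in>V. (dot r (w j) (w k))\<^sup>2)"
    by (rule sum.swap)
  \<comment> \<open>For fixed \<open>k\<close>, \<open>dot_ww\<close> is the centring of
    \<open>dot r (v j) (w k)\<close> in \<open>j\<close>, and centring only lowers a sum of squares.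
    The other index is treated in the same way below.\<close>
  also have "\<dots> \<le> (\<Sum>k\<in>V. \<Sum>j\<in>V. (dot r (v j) (w k))\<^sup>2)"
    unfolding dot_ww n_def by (intro sum_mono sum_centered_squares_le fin V_ne)
  also have "\<dots> = (\<Sum>j\<in>V. \<Sum>k\<in>V. (dot r (v j) (w k))\<^sup>2)"
    by (rule sum.swap)
  also have "\<dots> = (\<Sum>j\<in>V. \<Sum>k\<in>V. (a j k - (\<Sum>l\<in>V. a j l) / n)\<^sup>2)"
    by (intro sum.cong refl) (simp add: dot_vw')
  also have "\<dots> \<le> (\<Sum>j\<in>V. \<Sum>k\<in>V. (a j k)\<^sup>2)"
    unfolding n_def by (intro sum_mono sum_centered_squares_le fin V_ne)
  also have "\<dots> = (\<Sum>j\<in>V. \<Sum>k\<in>V. (if k = j then (1 - \<alpha>)\<^sup>2 else 0) + 4 * \<alpha>\<^sup>2 * adj j k)"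
    by (intro sum.cong refl) (auto simp: a_def adj_def power2_eq_square)
  also have "\<dots> = 4 * \<alpha>\<^sup>2 * (n * lam\<^sup>2 + vol V)"
    using fin unfolding lam_\<alpha>
    by (simp add: sum.distrib sum_distrib_left[symmetric] vol_def deg_def n_def algebra_simps power2_eq_square)
  finally have frob: "(\<Sum>j\<in>V. \<Sum>k\<in>V. (dot r (w j) (w k))\<^sup>2) \<le> 4 * \<alpha>\<^sup>2 * (n * lam\<^sup>2 + vol V)" .
  have "(\<Sum>k\<in>V. dot r (w k) (w k)) = (\<Sum>k\<in>V. dot r (v k) (w k)) - (\<Sum>k\<in>V. \<Sum>l\<in>V. dot r (v l) (w k)) / n"
    unfolding dot_ww by (simp add: sum_subtractf sum_divide_distrib)
  also have "(\<Sum>k\<in>V. \<Sum>l\<in>V. dot r (v l) (w k)) = (\<Sum>l\<in>V. \<Sum>k\<in>V. dot r (v l) (w k))"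
    by (rule sum.swap)
  also have "\<dots> = (\<Sum>l\<in>V. 0)"
    using n0 by (intro sum.cong refl) (simp add: dot_vw sum_subtractf n_def)
  also have "(\<Sum>k\<in>V. dot r (v k) (w k)) = (\<Sum>k\<in>V. a k k) - (\<Sum>k\<in>V. \<Sum>l\<in>V. a k l) / n"
    by (simp add: dot_vw' sum_subtractf sum_divide_distrib)
  also have "(\<Sum>k\<in>V. a k k) = n * (1 - \<alpha>)" by (simp add: a_def n_def)
  also have "(\<Sum>k\<in>V. \<Sum>l\<in>V. a k l) = n * (1 - \<alpha>) - 2 * \<alpha> * vol V"
    using fin by (simp add: a_def sum_subtractf sum_distrib_left[symmetric] vol_def deg_def n_def)
  finally have "(\<Sum>k\<in>V. dot r (w k) (w k)) = (n - 1) * (1 - \<alpha>) + 2 * \<alpha> * vol V / n"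
    using n0 by (simp add: field_simps)
  also have "\<dots> \<ge> (n - 1) * (1 - \<alpha>)"
    using \<alpha>0 n0 by (simp add: vol_def sum_nonneg deg_nonneg)
  finally have "((n - 1) * (1 - \<alpha>))\<^sup>2 \<le> (\<Sum>k\<in>V. dot r (w k) (w k))\<^sup>2"
    using n_ge_1 \<alpha>1 by (intro power_mono) auto
  also have "\<dots> \<le> real r * (\<Sum>j\<in>V. \<Sum>k\<in>V. (dot r (w j) (w k))\<^sup>2)" by (rule trace_squared_le)
  also have "\<dots> \<le> real r * (4 * \<alpha>\<^sup>2 * (n * lam\<^sup>2 + vol V))" using frob by (intro mult_left_mono) auto
  also have "\<dots> = (4 * \<alpha>\<^sup>2) * (real r * (n * lam\<^sup>2 + vol V))" by simp
  also have "((n - 1) * (1 - \<alpha>))\<^sup>2 = (4 * \<alpha>\<^sup>2) * ((n - 1)\<^sup>2 * lam\<^sup>2)"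
    unfolding lam_\<alpha> power_mult_distrib by simp
  finally have "(4 * \<alpha>\<^sup>2) * ((n - 1)\<^sup>2 * lam\<^sup>2) \<le> (4 * \<alpha>\<^sup>2) * (real r * (n * lam\<^sup>2 + vol V))" .
  then show ?thesis using \<alpha>0 by simp
qed

end

section \<open>Bounds on equiangular lines\<close>

text \<open>The summand 61 yields \<open>n \<alpha>^5 > 60\<close> for \<open>deg_le\<close>. With
  \<open>k = tree_size s * 2^(s + 3)\<close>, the second summand keeps the relative error
  \<open>k / C\<close> below 1, and the third keeps the total error \<open>3 k / C + 8 / C\<close>
  below \<delta>.\<close>

definition dim_threshold :: "nat \<Rightarrow> real \<Rightarrow> real" where
  "dim_threshold s \<delta> = 61 + real (tree_size s) * 2 ^ (s + 3) + (3 * (real (tree_size s) * 2 ^ (s + 3)) + 8) / \<delta>"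

lemma dim_threshold:
  fixes s :: nat and \<delta> :: real
  assumes "\<delta> > 0"
  defines "C \<equiv> dim_threshold s \<delta>" and "k \<equiv> real (tree_size s) * 2 ^ (s + 3)"
  shows "C \<ge> 61" "0 \<le> k / C" "k / C \<le> 1" "3 * (k / C) + 8 / C \<le> \<delta>"
proof -
  have k: "k \<ge> 0" unfolding k_def by simp
  have C: "C = 61 + k + (3 * k + 8) / \<delta>" unfolding C_def k_def dim_threshold_def ..
  have q: "(3 * k + 8) / \<delta> \<ge> 0" using k assms(1) by simp
  show C61: "C \<ge> 61" using C k q by linarith
  then show "0 \<le> k / C" using k by simp
  show "k / C \<le> 1" using C k q C61 by simp
  have "(3 * k + 8) / \<delta> \<le> C" using C k by simp
  then have "3 * k + 8 \<le> \<delta> * C" using assms(1) by (simp add: field_simps)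
  then show "3 * (k / C) + 8 / C \<le> \<delta>" using C61 by (simp add: field_simps)
qed

context equi_graph
begin

lemma card_le_of_vol:
  assumes "vol V \<le> d * n"
  shows "n - 2 \<le> real r * (1 + d / lam\<^sup>2)"
proof -
  have n0: "n > 0" using n_ge_1 by simp
  have l2: "lam\<^sup>2 > 0" using lam_pos by simp
  have "lam\<^sup>2 * (n - 1)\<^sup>2 \<le> real r * (n * lam\<^sup>2 + d * n)"
    using trace_bound mult_left_mono[OF add_left_mono[OF assms, of "n * lam\<^sup>2"], of "real r"]
    by (simp add: mult.commute)
  also have "\<dots> = lam\<^sup>2 * (n * (real r * (1 + d / lam\<^sup>2)))"
    using l2 by (simp add: field_simps)
  finally have "(n - 1)\<^sup>2 \<le> n * (real r * (1 + d / lam\<^sup>2))"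
    using l2 by simp
  moreover have "n * (n - 2) \<le> (n - 1)\<^sup>2" by (simp add: power2_eq_square algebra_simps)
  ultimately have "n * (n - 2) \<le> n * (real r * (1 + d / lam\<^sup>2))" by linarith
  then show ?thesis using n0 by simp
qed

lemma lam_bounds:
  assumes "\<alpha> \<le> 1/2"
  shows "lam \<le> 1 / (2 * \<alpha>)" "1 / \<alpha> \<le> 4 * lam" "lam \<ge> 1/2"
proof -
  show "lam \<le> 1 / (2 * \<alpha>)" unfolding lam_def using \<alpha>0 by (intro divide_right_mono) auto
  show *: "1 / \<alpha> \<le> 4 * lam" unfolding lam_def using \<alpha>0 assms by (simp add: field_simps)
  have "2 \<le> 1 / \<alpha>" using \<alpha>0 assms by (simp add: field_simps)
  with * show "lam \<ge> 1/2" by simp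
qed

text \<open>A star with only \<open>D\<close>, about \<open>4 \<lambda>^2\<close>, leaves already
  has eigenvalue at least \<open>2 \<lambda>\<close>, exceeding \<lambda> by \<lambda>. The centring
  cost is at most \<open>120 \<lambda>^2 / (\<alpha>^4 n)\<close>, using
  \<open>D + 1 \<le> 12 \<lambda>^2\<close>, and \<open>\<lambda> \<alpha> \<le> 1/2\<close> makes
  it too small when \<open>n \<alpha>^5 > 60\<close>.\<close>

lemma deg_le:
  assumes "\<alpha> \<le> 1/2" and \<Delta>: "\<And>u. u \<in> V \<Longrightarrow> deg V u \<le> 5 / \<alpha> ^ 4"
    and n: "n * \<alpha> ^ 5 > 60" and u: "u \<in> V"
  shows "deg V u \<le> 4 * lam\<^sup>2"
proof (rule ccontr)
  assume gt: "\<not> deg V u \<le> 4 * lam\<^sup>2"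
  define D where "D = nat \<lceil>4 * lam\<^sup>2\<rceil>"
  have l2: "lam\<^sup>2 \<ge> 1/4" using power_mono[OF lam_bounds(3)[OF assms(1)], of 2] by (simp add: power2_eq_square)
  have D: "4 * lam\<^sup>2 \<le> real D" "real D \<le> 4 * lam\<^sup>2 + 1" "D > 0"
    using l2 unfolding D_def by linarith+
  have "real D \<le> deg V u"
  proof -
    define m where "m = card {w\<in>V. u \<noteq> w \<and> dot r (v u) (v w) < 0}"
    have m: "deg V u = real m" unfolding m_def by (rule deg_card[OF fin])
    then have "4 * lam\<^sup>2 \<le> of_int (int m)" using gt by simp
    then have "\<lceil>4 * lam\<^sup>2\<rceil> \<le> int m" by (rule ceiling_le)
    then show ?thesis unfolding m D_def by simp
  qed
  then have "sqrt D \<le> lam + 2 * (5 / \<alpha> ^ 4) * (real D + 1) / n"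
    using star_bound[OF \<Delta> u _ D(3)] by simp
  moreover have "sqrt D \<ge> 2 * lam"
    using D(1) lam_pos by (intro real_le_rsqrt) (simp add: power_mult_distrib)
  moreover have "2 * (5 / \<alpha> ^ 4) * (real D + 1) / n \<le> 2 * (5 / \<alpha> ^ 4) * (12 * lam\<^sup>2) / n"
    using D(2) l2 \<alpha>0 n_ge_1 by (intro divide_right_mono mult_left_mono) auto
  ultimately have "lam \<le> 120 * lam\<^sup>2 / (\<alpha> ^ 4 * n)" by simp
  then have "lam * (n * \<alpha> ^ 4) \<le> lam * (120 * lam)"
    using \<alpha>0 n_ge_1 by (simp add: field_simps power2_eq_square)
  then have "n * \<alpha> ^ 4 \<le> 120 * lam" using lam_pos by simp
  then have "n * \<alpha> ^ 4 * \<alpha> \<le> 120 * lam * \<alpha>" using \<alpha>0 by (intro mult_right_mono) auto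
  also have "\<dots> \<le> 120 * (1 / (2 * \<alpha>)) * \<alpha>"
    using \<alpha>0 lam_bounds(1)[OF assms(1)] by (intro mult_right_mono mult_left_mono) auto
  also have "\<dots> = 60" using \<alpha>0 by simp
  also have "n * \<alpha> ^ 4 * \<alpha> = n * \<alpha> ^ 5" by (simp add: eval_nat_numeral)
  finally show False using n by simp
qed

lemma average_degree_le:
  fixes d C :: real
  assumes \<alpha>: "\<alpha> \<le> 1/2" and \<Delta>: "\<And>u. u \<in> V \<Longrightarrow> deg V u \<le> 4 * lam\<^sup>2" and s: "s \<ge> 2"
    and C: "C > 0" "n * \<alpha> ^ (2 * s + 1) \<ge> C" and d: "d \<ge> 1" "vol V \<ge> d * n"
  defines "c \<equiv> cos (pi / (real s + 2))"
  shows "d \<le> 1 + lam\<^sup>2 * (1 + real (tree_size s) * 2 ^ (s + 3) / C)\<^sup>2 / (4 * c\<^sup>2)"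
proof -
  define k where "k = real (tree_size s)"
  have k0: "k \<ge> 0" unfolding k_def by simp
  have c: "c > 0" unfolding c_def using s by (intro cos_gt_zero) (auto simp: field_simps)
  obtain W x where W: "W \<subseteq> V" and x: "\<And>u. 0 \<le> x u" "\<And>u. u \<notin> W \<Longrightarrow> x u = 0"
    and card: "real (card W) \<le> k * (1 + 4 * lam\<^sup>2) ^ s" and X: "0 < (\<Sum>u\<in>V. (x u)\<^sup>2)"
    and q: "2 * c * sqrt (d - 1) * (\<Sum>u\<in>V. (x u)\<^sup>2) \<le> quad V x"
    using exists_local_vector[OF fin V_ne \<Delta> d(1), of s] d(2) unfolding n_def c_def k_def by blast
  have n0: "n > 0" using n_ge_1 by simp
  have "quad V x \<le> (lam + 2 * (4 * lam\<^sup>2) * card W / n) * (\<Sum>u\<in>V. (x u)\<^sup>2)"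
    by (rule quad_le[OF W x \<Delta>])
  with q have "2 * c * sqrt (d - 1) * (\<Sum>u\<in>V. (x u)\<^sup>2) \<le> (lam + 2 * (4 * lam\<^sup>2) * card W / n) * (\<Sum>u\<in>V. (x u)\<^sup>2)"
    by linarith
  then have main: "2 * c * sqrt (d - 1) \<le> lam + 2 * (4 * lam\<^sup>2) * card W / n"
    using X by simp
  have l2: "4 * lam\<^sup>2 \<le> 1 / \<alpha>\<^sup>2"
    using power_mono[OF lam_bounds(1)[OF \<alpha>], of 2] lam_pos by (simp add: power_divide power_mult_distrib)
  have "1 \<le> 1 / \<alpha>\<^sup>2" using \<alpha>0 \<alpha>1 by (simp add: power_le_one)
  with l2 have "1 + 4 * lam\<^sup>2 \<le> 2 / \<alpha>\<^sup>2" by simp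
  then have "(1 + 4 * lam\<^sup>2) ^ s \<le> (2 / \<alpha>\<^sup>2) ^ s" by (intro power_mono) auto
  then have "k * (1 + 4 * lam\<^sup>2) ^ s \<le> k * (2 / \<alpha>\<^sup>2) ^ s" using k0 by (rule mult_left_mono)
  with card have card': "real (card W) \<le> k * (2 / \<alpha>\<^sup>2) ^ s" by linarith
  \<comment> \<open>The final \<open>2^(s + 3)\<close> collects a factor 2 from centring,
    \<open>2^s\<close> from \<open>1 + 4 \<lambda>^2 \<le> 2 / \<alpha>^2\<close>, and 4 from
    \<open>1 / \<alpha> \<le> 4 \<lambda>\<close>.\<close>
  have "2 * (4 * lam\<^sup>2) * card W / n \<le> 2 * (1 / \<alpha>\<^sup>2) * (k * (2 / \<alpha>\<^sup>2) ^ s) / n"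
    using card' l2 n0 k0 \<alpha>0 by (intro divide_right_mono mult_mono) auto
  also have "\<dots> = (k * 2 ^ (s + 1)) * (1 / \<alpha>) / (n * \<alpha> ^ (2 * s + 1))"
    using n0 \<alpha>0 by (simp add: power_divide power_mult power2_eq_square field_simps)
  also have "\<dots> \<le> (k * 2 ^ (s + 1)) * (4 * lam) / C"
    using C k0 lam_pos lam_bounds(2)[OF \<alpha>] by (intro frac_le mult_left_mono mult_nonneg_nonneg) auto
  also have "\<dots> = lam * (k * 2 ^ (s + 3) / C)" by (simp add: power_add)
  finally have "2 * c * sqrt (d - 1) \<le> lam * (1 + k * 2 ^ (s + 3) / C)"
    using main by (simp add: distrib_left)
  then have "(2 * c * sqrt (d - 1))\<^sup>2 \<le> (lam * (1 + k * 2 ^ (s + 3) / C))\<^sup>2"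
    using c d(1) by (intro power_mono) auto
  then have "4 * c\<^sup>2 * (d - 1) \<le> lam\<^sup>2 * (1 + k * 2 ^ (s + 3) / C)\<^sup>2"
    using d(1) by (simp add: power_mult_distrib)
  then have "d - 1 \<le> lam\<^sup>2 * (1 + k * 2 ^ (s + 3) / C)\<^sup>2 / (4 * c\<^sup>2)"
    using c by (simp add: field_simps)
  then show ?thesis unfolding k_def by simp
qed

lemma card_bound:
  assumes \<alpha>: "\<alpha> \<le> 1/2" and \<Delta>: "\<And>u. u \<in> V \<Longrightarrow> deg V u \<le> 5 / \<alpha> ^ 4" and s: "s \<ge> 2"
    and \<delta>: "\<delta> > 0" and r: "real r * \<alpha> ^ (2 * s + 1) \<ge> dim_threshold s \<delta>"
  defines "c \<equiv> cos (pi / (real s + 2))"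
  shows "n \<le> (1 + 1 / lam\<^sup>2 + (1 + \<delta>) / (4 * c\<^sup>2)) * real r"
proof (cases "n \<le> real r")
  case True
  also have "real r \<le> (1 + 1 / lam\<^sup>2 + (1 + \<delta>) / (4 * c\<^sup>2)) * real r"
    using mult_right_mono[of 1 "1 + 1 / lam\<^sup>2 + (1 + \<delta>) / (4 * c\<^sup>2)" "real r"] \<delta> by simp
  finally show ?thesis .
next
  \<comment> \<open>Now \<open>n\<close> exceeds \<open>r\<close>, so the size assumption on
    \<open>r\<close> passes to \<open>n\<close>, where the spectral estimates need it.\<close>
  case False
  define C where "C = dim_threshold s \<delta>"
  define e where "e = real (tree_size s) * 2 ^ (s + 3) / C"
  have C61: "C \<ge> 61" and e: "0 \<le> e" "e \<le> 1" "3 * e + 8 / C \<le> \<delta>"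
    using dim_threshold[OF \<delta>, of s] unfolding C_def e_def by auto
  have c: "c > 0" "c \<le> 1" unfolding c_def using s by (auto intro!: cos_gt_zero simp: field_simps)
  have c2: "0 < 4 * c\<^sup>2" "4 * c\<^sup>2 \<le> 4" using c power_le_one[of c 2] by auto
  have pow: "\<alpha> ^ (2 * s + 1) \<le> \<alpha> ^ 5" "\<alpha> ^ (2 * s + 1) \<le> 1"
    using \<alpha>0 \<alpha>1 s by (intro power_decreasing power_le_one; simp)+
  have rC: "real r \<ge> C"
    using r mult_left_mono[OF pow(2), of "real r"] unfolding C_def by simp
  have nC: "n * \<alpha> ^ (2 * s + 1) \<ge> C"
  proof -
    have "real r * \<alpha> ^ (2 * s + 1) \<le> n * \<alpha> ^ (2 * s + 1)"
      using False \<alpha>0 by (intro mult_right_mono) auto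
    then show ?thesis using r unfolding C_def by linarith
  qed
  then have "n * \<alpha> ^ 5 > 60"
    using mult_left_mono[OF pow(1), of n] n_ge_1 C61 by linarith
  then have \<Delta>': "\<And>u. u \<in> V \<Longrightarrow> deg V u \<le> 4 * lam\<^sup>2"
    using deg_le[OF \<alpha> \<Delta>] by blast
  define d where "d = vol V / n"
  have d: "vol V = d * n" unfolding d_def using n_ge_1 by simp
  have l2: "lam\<^sup>2 > 0" using lam_pos by simp
  have "d \<le> 1 + lam\<^sup>2 * (1 + e)\<^sup>2 / (4 * c\<^sup>2)"
  proof (cases "d \<ge> 1")
    case True
    show ?thesis
      using average_degree_le[OF \<alpha> \<Delta>' s _ nC True] C61 d unfolding c_def e_def by simp
  next
    case False
    moreover have "lam\<^sup>2 * (1 + e)\<^sup>2 / (4 * c\<^sup>2) \<ge> 0" by simp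
    ultimately show ?thesis by linarith
  qed
  then have "d / lam\<^sup>2 \<le> (1 + lam\<^sup>2 * (1 + e)\<^sup>2 / (4 * c\<^sup>2)) / lam\<^sup>2"
    using l2 by (intro divide_right_mono) auto
  also have "\<dots> = 1 / lam\<^sup>2 + (1 + e)\<^sup>2 / (4 * c\<^sup>2)" using l2 by (simp add: add_divide_distrib)
  finally have "1 + d / lam\<^sup>2 \<le> 1 + 1 / lam\<^sup>2 + (1 + e)\<^sup>2 / (4 * c\<^sup>2)" by simp
  then have "real r * (1 + d / lam\<^sup>2) \<le> real r * (1 + 1 / lam\<^sup>2 + (1 + e)\<^sup>2 / (4 * c\<^sup>2))"
    by (rule mult_left_mono) simp
  then have "n \<le> real r * (1 + 1 / lam\<^sup>2 + (1 + e)\<^sup>2 / (4 * c\<^sup>2)) + 2"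
    using card_le_of_vol[of d] d by simp
  \<comment> \<open>The additive 2 from the trace inequality is absorbed into the error term, using
    \<open>r \<ge> C\<close> and \<open>c \<le> 1\<close>.\<close>
  also have "2 \<le> real r * ((8 / C) / (4 * c\<^sup>2))"
  proof -
    have "2 * (C * (4 * c\<^sup>2)) \<le> 2 * (real r * 4)"
      using rC c2 C61 by (intro mult_left_mono mult_mono) auto
    then show ?thesis using C61 c2 by (simp add: field_simps)
  qed
  also have "real r * (1 + 1 / lam\<^sup>2 + (1 + e)\<^sup>2 / (4 * c\<^sup>2)) + real r * ((8 / C) / (4 * c\<^sup>2))
     = real r * (1 + 1 / lam\<^sup>2 + ((1 + e)\<^sup>2 + 8 / C) / (4 * c\<^sup>2))"
    by (simp only: distrib_left add_divide_distrib add.assoc)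
  also have "\<dots> \<le> real r * (1 + 1 / lam\<^sup>2 + (1 + \<delta>) / (4 * c\<^sup>2))"
  proof -
    have "e * e \<le> 1 * e" using e by (intro mult_right_mono) auto
    then have "(1 + e)\<^sup>2 + 8 / C \<le> 1 + \<delta>" using e by (simp add: power2_eq_square algebra_simps)
    then show ?thesis using c2 by (intro mult_left_mono add_left_mono divide_right_mono) auto
  qed
  finally show ?thesis by (simp add: mult.commute)
qed

end

text \<open>Above \<open>1/2\<close>, three lines with a negative product of inner products cannot exist, since
  \<open>|v\<^sub>j + v\<^sub>k - 2\<alpha> v\<^sub>z|\<^sup>2\<close> would equal \<open>2 (1 + \<alpha>) (1 - 2\<alpha>) < 0\<close>.\<close>

lemma card_le_large_angle:
  assumes eq: "equi_vecs r \<alpha> V v" and \<alpha>: "1/2 < \<alpha>" "\<alpha> < 1"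
  shows "real (card V) \<le> real r + 2"
proof (cases "V = {}")
  case True
  then show ?thesis by simp
next
  case False
  then obtain z where z: "z \<in> V" by blast
  have \<alpha>0: "\<alpha> > 0" using \<alpha>(1) by simp
  obtain w where w: "equi_vecs r \<alpha> V w" "\<And>k. k \<in> V \<Longrightarrow> k \<noteq> z \<Longrightarrow> dot r (w z) (w k) = \<alpha>"
    using switch_positive_row[OF eq z \<alpha>0] by blast
  interpret equi_graph r \<alpha> V w
    using w(1) \<alpha> False by unfold_locales auto
  have "adj j k = 0" if jk: "j \<in> V" "k \<in> V" for j k
  proof (rule ccontr)
    assume "adj j k \<noteq> 0"
    then have neg: "j \<noteq> k" "dot r (w j) (w k) < 0" by (auto simp: adj_def)
    then have jz: "j \<noteq> z" "k \<noteq> z" using w(2)[OF jk(1)] w(2)[OF jk(2)] \<alpha> dot_commute[of r "w j" "w z"] by auto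
    have one: "dot r (w i) (w i) = 1" if "i \<in> V" for i using w(1) that unfolding equi_vecs_def by simp
    have "\<bar>dot r (w j) (w k)\<bar> = \<alpha>" using w(1) neg(1) jk unfolding equi_vecs_def by metis
    then have "dot r (w j) (w k) = - \<alpha>" using neg(2) by simp
    moreover define f where "f i = (if i = z then - 2 * \<alpha> else 1)" for i
    have "0 \<le> (\<Sum>a\<in>{z, j, k}. \<Sum>b\<in>{z, j, k}. f a * f b * dot r (w a) (w b))"
      by (rule gram_psd) simp
    ultimately have "0 \<le> 2 - 2 * \<alpha> - 4 * \<alpha>\<^sup>2"
      using neg(1) jz w(2)[OF jk(1) jz(1)] w(2)[OF jk(2) jz(2)] one[OF z] one[OF jk(1)] one[OF jk(2)]
        dot_commute[of r "w j" "w z"] dot_commute[of r "w k" "w z"] dot_commute[of r "w k" "w j"]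
      by (simp add: f_def power2_eq_square algebra_simps)
    moreover have "2 - 2 * \<alpha> - 4 * \<alpha>\<^sup>2 = 2 * (1 + \<alpha>) * (1 - 2 * \<alpha>)"
      by (simp add: power2_eq_square algebra_simps)
    moreover have "2 * (1 + \<alpha>) * (1 - 2 * \<alpha>) < 0" using \<alpha> by (intro mult_pos_neg) auto
    ultimately show False by linarith
  qed
  then have "vol V \<le> 0 * n" by (simp add: vol_def deg_def)
  from card_le_of_vol[OF this] show ?thesis by (simp add: n_def)
qed

text \<open>The size assumption is asked only for \<open>\<alpha> \<le> 1/2\<close>: when \<alpha>
  is near 1, a bound \<open>r \<ge> \<alpha> powr (- w)\<close> with large \<open>w\<close> need not
  make \<open>r\<close> large.\<close>

lemma equi_vecs_card_bound:
  assumes eq: "equi_vecs r \<alpha> V v" and \<alpha>: "0 < \<alpha>" "\<alpha> < 1" and r: "r \<ge> 1" and s: "s \<ge> 2" and \<delta>: "\<delta> > 0"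
    and large: "\<alpha> \<le> 1/2 \<Longrightarrow> real r * \<alpha> ^ (2 * s + 1) \<ge> dim_threshold s \<delta>"
  shows "real (card V) \<le> (1 + (2 * \<alpha> / (1 - \<alpha>))\<^sup>2 + (1 + \<delta>) / (4 * (cos (pi / (real s + 2)))\<^sup>2)) * real r"
proof -
  let ?A = "(2 * \<alpha> / (1 - \<alpha>))\<^sup>2" and ?B = "(1 + \<delta>) / (4 * (cos (pi / (real s + 2)))\<^sup>2)"
  have B: "?B \<ge> 0" using \<delta> by simp
  consider "V = {}" | "V \<noteq> {}" "\<alpha> \<le> 1/2" | "\<alpha> > 1/2" by linarith
  then show ?thesis
  proof cases
    case 1
    then show ?thesis using B by simp
  next
    case 2
    obtain w where w: "equi_vecs r \<alpha> V w"
      "\<And>j. j \<in> V \<Longrightarrow> real (card {k\<in>V. j \<noteq> k \<and> dot r (w j) (w k) < 0}) \<le> 5 / \<alpha> ^ 4"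
      using switch_small_degree[OF eq \<alpha>] by blast
    interpret equi_graph r \<alpha> V w
      using w(1) \<alpha> 2(1) by unfold_locales auto
    have "1 / lam\<^sup>2 = ?A" unfolding lam_def by (simp add: power_divide)
    then show ?thesis
      using card_bound[OF 2(2) _ s \<delta> large[OF 2(2)]] w(2) unfolding deg_card[OF fin] n_def by simp
  next
    case 3
    \<comment> \<open>In this range the angle term alone is at least 4, so the bound
      \<open>r + 2\<close> is more than covered.\<close>
    have "2 \<le> 2 * \<alpha> / (1 - \<alpha>)" using 3 \<alpha> by (simp add: field_simps)
    then have "2\<^sup>2 \<le> ?A" by (intro power_mono) auto
    then have "3 * real r \<le> (1 + ?A + ?B) * real r" using B by (intro mult_right_mono) auto
    moreover have "real (card V) \<le> real r + 2" using card_le_large_angle[OF eq 3 \<alpha>(2)] .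
    moreover have "real r \<ge> 1" using r by simp
    ultimately show ?thesis by linarith
  qed
qed

section \<open>From lines to unit vectors\<close>

lemma equi_vecs_of_lines:
  assumes "finite L" "equiangular_lines r \<alpha> L"
  obtains v where "equi_vecs r \<alpha> L v"
proof -
  have unit: "\<exists>u. u \<in> l \<and> dim_vec u = r \<and> scalar_prod u u = (1 :: real)" if l: "l \<in> L" for l
  proof -
    have "l \<in> lines_through_origin r" using assms(2) l unfolding equiangular_lines_def by blast
    then obtain w where w: "l = range (\<lambda>c. c \<cdot>\<^sub>v w)" "w \<in> carrier_vec r" "w \<noteq> 0\<^sub>v r"
      unfolding lines_through_origin_def by blast
    have dim: "dim_vec w = r" using w(2) by simp
    obtain i where i: "i < r" "w $ i \<noteq> 0"
      using w(3) dim by (metis eq_vecI index_zero_vec)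
    define q where "q = scalar_prod w w"
    have "(w $ i)\<^sup>2 \<le> q"
      unfolding q_def scalar_prod_def dim power2_eq_square using i(1)
      by (intro member_le_sum[of i _ "\<lambda>i. w $ i * w $ i"]) auto
    then have q: "q > 0" using i(2) by (smt (verit) zero_less_power2)
    let ?u = "(1 / sqrt q) \<cdot>\<^sub>v w"
    have "scalar_prod ?u ?u = (1 / sqrt q) * ((1 / sqrt q) * q)"
      using w(2) smult_scalar_prod_distrib[of w r ?u "1 / sqrt q"]
        scalar_prod_smult_distrib[of w r w "1 / sqrt q"] unfolding q_def by simp
    also have "\<dots> = 1" using q by (simp add: field_simps)
    finally show ?thesis using w(1) dim by (intro exI[of _ ?u]) auto
  qed
  then obtain u where u: "\<And>l. l \<in> L \<Longrightarrow> u l \<in> l" "\<And>l. l \<in> L \<Longrightarrow> dim_vec (u l) = r"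
    "\<And>l. l \<in> L \<Longrightarrow> scalar_prod (u l) (u l) = 1"
    by metis
  define v where "v l p = u l $ p" for l p
  have dot: "dot r (v l) (v m) = scalar_prod (u l) (u m)" if "m \<in> L" for l m
    unfolding dot_def v_def scalar_prod_def u(2)[OF that] by (simp add: atLeast0LessThan)
  have "equi_vecs r \<alpha> L v"
    using assms u unfolding equi_vecs_def equiangular_lines_def by (auto simp: dot)
  then show ?thesis using that by blast
qed

lemma max_equiangular_le:
  assumes "\<And>L. finite L \<Longrightarrow> equiangular_lines r \<alpha> L \<Longrightarrow> real (card L) \<le> B"
  shows "real (max_equiangular \<alpha> r) \<le> B"
proof -
  let ?S = "{card L | L. finite L \<and> equiangular_lines r \<alpha> L}"
  \<comment> \<open>\<open>Max\<close> carries no information for an infinite set, so the uniform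
    bound is first used to make the set of sizes finite.\<close>
  have "x \<le> nat \<lfloor>B\<rfloor>" if "x \<in> ?S" for x using assms that by (auto simp: le_nat_floor)
  then have "finite ?S" by (meson finite_atMost finite_subset subsetI atMost_iff)
  moreover have "equiangular_lines r \<alpha> {}" unfolding equiangular_lines_def by simp
  then have "?S \<noteq> {}" by blast
  ultimately have "Max ?S \<in> ?S" by (rule Max_in)
  then show ?thesis unfolding max_equiangular_def using assms by auto
qed

lemma max_equiangular_bound:
  assumes "0 < \<alpha>" "\<alpha> < 1" "r \<ge> 1" "s \<ge> 2" "\<delta> > 0"
    and "\<alpha> \<le> 1/2 \<Longrightarrow> real r * \<alpha> ^ (2 * s + 1) \<ge> dim_threshold s \<delta>"
  shows "real (max_equiangular \<alpha> r) \<le>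
    (1 + (2 * \<alpha> / (1 - \<alpha>))\<^sup>2 + (1 + \<delta>) / (4 * (cos (pi / (real s + 2)))\<^sup>2)) * real r"
proof (rule max_equiangular_le)
  fix L assume "finite L" "equiangular_lines r \<alpha> L"
  then obtain v where "equi_vecs r \<alpha> L v" by (rule equi_vecs_of_lines)
  then show "real (card L) \<le> (1 + (2 * \<alpha> / (1 - \<alpha>))\<^sup>2 + (1 + \<delta>) / (4 * (cos (pi / (real s + 2)))\<^sup>2)) * real r"
    by (rule equi_vecs_card_bound[OF _ assms])
qed

section \<open>Error terms along the sequence\<close>

lemma cos_factor_limit:
  "(\<lambda>s. (1 + 1 / real s) / (4 * (cos (pi / (real s + 2)))\<^sup>2)) \<longlonglongrightarrow> 1 / 4"
proof -
  have "filterlim (\<lambda>s. real s + 2) at_top sequentially"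
    using filterlim_tendsto_add_at_top[OF tendsto_const filterlim_real_sequentially, of 2] by (simp add: add.commute)
  then have "(\<lambda>s. pi / (real s + 2)) \<longlonglongrightarrow> 0"
    by (intro real_tendsto_divide_at_top[OF tendsto_const])
  then have "(\<lambda>s. cos (pi / (real s + 2))) \<longlonglongrightarrow> cos 0" by (intro tendsto_cos)
  moreover have "(\<lambda>s. 1 / real s) \<longlonglongrightarrow> 0" by (rule lim_1_over_n)
  ultimately have "(\<lambda>s. (1 + 1 / real s) / (4 * (cos (pi / (real s + 2)))\<^sup>2)) \<longlonglongrightarrow> (1 + 0) / (4 * (cos 0)\<^sup>2)"
    by (intro tendsto_divide tendsto_add tendsto_mult tendsto_power tendsto_const) simp_all
  then show ?thesis by simp
qed

text \<open>Only upper bounds on the error are available; clipping at 0 turns them into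
  convergence.\<close>

lemma tendsto_max_0:
  fixes f :: "nat \<Rightarrow> real"
  assumes "\<And>e. e > 0 \<Longrightarrow> eventually (\<lambda>t. f t \<le> e) sequentially"
  shows "(\<lambda>t. max 0 (f t)) \<longlonglongrightarrow> 0"
proof (rule tendstoI)
  fix e :: real assume "e > 0"
  then have "eventually (\<lambda>t. f t \<le> e / 2) sequentially" by (intro assms) simp
  then show "eventually (\<lambda>t. dist (max 0 (f t)) 0 < e) sequentially"
    by eventually_elim (use \<open>e > 0\<close> in auto)
qed

text \<open>The exponent \<open>k - w\<close> is negative and \<open>\<alpha> \<le> 1/2\<close>, so
  \<open>\<alpha> powr (k - w)\<close> is at least \<open>2 powr (w - k)\<close>, hence at least
  \<open>C\<close>.\<close>

lemma powr_threshold: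
  assumes \<alpha>: "0 < \<alpha>" "\<alpha> \<le> 1/2" and x: "x \<ge> \<alpha> powr (- w)" and C: "C \<ge> 1" and w: "w \<ge> real k + log 2 C"
  shows "x * \<alpha> ^ k \<ge> C"
proof -
  have "log 2 C \<ge> 0" using C by simp
  then have le: "real k - w \<le> 0" using w by linarith
  have "log 2 C \<le> w - real k" using w by simp
  then have "C \<le> 2 powr (w - real k)" using C by (simp add: log_le_iff)
  also have "\<dots> = (1/2) powr (real k - w)" by (simp add: powr_divide powr_minus_divide powr_diff)
  also have "\<dots> \<le> \<alpha> powr (real k - w)"
    using \<alpha> le by (intro powr_mono2') auto
  also have "\<dots> = \<alpha> powr (- w) * \<alpha> ^ k" using \<alpha> by (simp add: powr_add[symmetric] powr_realpow[symmetric])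
  also have "\<dots> \<le> x * \<alpha> ^ k" using x \<alpha> by (intro mult_right_mono) auto
  finally show ?thesis .
qed

theorem theorem1p4:
  fixes \<alpha> :: "nat \<Rightarrow> real" and r :: "nat \<Rightarrow> nat"
  assumes "\<forall>t\<ge>1. 0 < \<alpha> t \<and> \<alpha> t < 1"
    and "\<forall>t\<ge>1. r t \<ge> 1"
  shows "(\<forall>s::nat. s \<ge> 2 \<longrightarrow>
            filterlim (\<lambda>t. real (r t) * \<alpha> t ^ (2 * s + 1)) at_top sequentially \<longrightarrow>
            (\<exists>\<epsilon> :: nat \<Rightarrow> real. \<epsilon> \<longlonglongrightarrow> 0 \<and>
              (\<forall>t\<ge>1. real (max_equiangular (\<alpha> t) (r t)) \<le>
                 (1 + (2 * \<alpha> t / (1 - \<alpha> t))\<^sup>2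
                    + (1 + \<epsilon> t) / (4 * (cos (pi / (real s + 2)))\<^sup>2)) * real (r t))))
       \<and> (\<forall>w :: nat \<Rightarrow> real.
            filterlim w at_top sequentially \<longrightarrow>
            (\<forall>t\<ge>1. real (r t) \<ge> \<alpha> t powr (- w t)) \<longrightarrow>
            (\<exists>\<epsilon> :: nat \<Rightarrow> real. \<epsilon> \<longlonglongrightarrow> 0 \<and>
              (\<forall>t\<ge>1. real (max_equiangular (\<alpha> t) (r t)) \<le>
                 (5 / 4 + (2 * \<alpha> t / (1 - \<alpha> t))\<^sup>2 + \<epsilon> t) * real (r t))))"
proof (intro conjI allI impI)
  fix s :: nat
  assume s: "s \<ge> 2" and lim: "filterlim (\<lambda>t. real (r t) * \<alpha> t ^ (2 * s + 1)) at_top sequentially"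
  let ?A = "\<lambda>t. (2 * \<alpha> t / (1 - \<alpha> t))\<^sup>2" and ?N = "\<lambda>t. real (max_equiangular (\<alpha> t) (r t))"
  let ?c = "4 * (cos (pi / (real s + 2)))\<^sup>2"
  have "cos (pi / (real s + 2)) > 0" using s by (intro cos_gt_zero) (auto simp: field_simps)
  then have c: "?c > 0" by simp
  \<comment> \<open>This is the error that would turn the claimed inequality into an equality; its
    positive part is the witness and works for every \<open>t \<ge> 1\<close>, including the early
    ones.\<close>
  define f where "f t = (?N t / real (r t) - 1 - ?A t) * ?c - 1" for t
  have "eventually (\<lambda>t. f t \<le> e) sequentially" if e: "e > 0" for e
  proof -
    have "eventually (\<lambda>t. real (r t) * \<alpha> t ^ (2 * s + 1) \<ge> dim_threshold s e) sequentially"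
      using lim by (auto simp: filterlim_at_top)
    then show ?thesis
      using eventually_ge_at_top[of 1]
    proof eventually_elim
      case (elim t)
      have \<alpha>: "0 < \<alpha> t" "\<alpha> t < 1" and r: "r t \<ge> 1" using assms elim(2) by auto
      have "?N t \<le> (1 + ?A t + (1 + e) / ?c) * real (r t)"
        by (rule max_equiangular_bound[OF \<alpha> r s e elim(1)])
      then have "?N t / real (r t) \<le> 1 + ?A t + (1 + e) / ?c"
        using r by (simp add: pos_divide_le_eq)
      then have "?N t / real (r t) - 1 - ?A t \<le> (1 + e) / ?c" by linarith
      then show "f t \<le> e" unfolding f_def using c by (simp add: pos_le_divide_eq)
    qed
  qed
  then have "(\<lambda>t. max 0 (f t)) \<longlonglongrightarrow> 0" by (rule tendsto_max_0)
  moreover have "?N t \<le> (1 + ?A t + (1 + max 0 (f t)) / ?c) * real (r t)" if "t \<ge> 1" for t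
  proof -
    have r: "real (r t) > 0" using assms(2) that by fastforce
    have "(?N t / real (r t) - 1 - ?A t) * ?c \<le> 1 + max 0 (f t)" unfolding f_def by simp
    then have "?N t / real (r t) - 1 - ?A t \<le> (1 + max 0 (f t)) / ?c" using c by (simp add: pos_le_divide_eq)
    then have "?N t / real (r t) \<le> 1 + ?A t + (1 + max 0 (f t)) / ?c" by linarith
    then show ?thesis using r by (simp add: pos_divide_le_eq)
  qed
  ultimately show "\<exists>\<epsilon> :: nat \<Rightarrow> real. \<epsilon> \<longlonglongrightarrow> 0 \<and> (\<forall>t\<ge>1. ?N t \<le> (1 + ?A t + (1 + \<epsilon> t) / ?c) * real (r t))"
    by blast
next
  fix w :: "nat \<Rightarrow> real"
  assume w: "filterlim w at_top sequentially" and rw: "\<forall>t\<ge>1. real (r t) \<ge> \<alpha> t powr (- w t)"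
  let ?A = "\<lambda>t. (2 * \<alpha> t / (1 - \<alpha> t))\<^sup>2" and ?N = "\<lambda>t. real (max_equiangular (\<alpha> t) (r t))"
  define f where "f t = ?N t / real (r t) - 5 / 4 - ?A t" for t
  have "eventually (\<lambda>t. f t \<le> e) sequentially" if e: "e > 0" for e
  proof -
    \<comment> \<open>For each tolerance \<open>e\<close> one fixed \<open>s\<close> is chosen, with
      \<delta> tied to it as \<open>1 / s\<close>, so that a single limit brings the factor below
      \<open>1 / 4 + e\<close>. The witness itself does not depend on \<open>s\<close>.\<close>
    let ?B = "\<lambda>s. (1 + 1 / real s) / (4 * (cos (pi / (real s + 2)))\<^sup>2)"
    have "eventually (\<lambda>s. ?B s < 1 / 4 + e) sequentially"
      using cos_factor_limit e by (intro order_tendstoD(2)) auto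
    then have "eventually (\<lambda>s. ?B s < 1 / 4 + e \<and> s \<ge> 2) sequentially"
      using eventually_ge_at_top by (rule eventually_conj)
    then obtain s where s: "?B s < 1 / 4 + e" "s \<ge> 2"
      using eventually_happens'[OF sequentially_bot] by blast
    have \<delta>: "1 / real s > 0" using s(2) by simp
    have C: "dim_threshold s (1 / real s) \<ge> 1" using dim_threshold(1)[OF \<delta>, of s] by simp
    have "eventually (\<lambda>t. w t \<ge> real (2 * s + 1) + log 2 (dim_threshold s (1 / real s))) sequentially"
      using w unfolding filterlim_at_top by blast
    then show ?thesis
      using eventually_ge_at_top[of 1]
    proof eventually_elim
      case (elim t)
      have \<alpha>: "0 < \<alpha> t" "\<alpha> t < 1" and r: "r t \<ge> 1" and rwt: "real (r t) \<ge> \<alpha> t powr (- w t)"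
        using assms rw elim(2) by auto
      have "?N t \<le> (1 + ?A t + ?B s) * real (r t)"
        by (rule max_equiangular_bound[OF \<alpha> r s(2) \<delta> powr_threshold[OF \<alpha>(1) _ rwt C elim(1)]])
      then have "?N t / real (r t) \<le> 1 + ?A t + ?B s"
        using r by (simp add: pos_divide_le_eq)
      then show "f t \<le> e" unfolding f_def using s(1) by linarith
    qed
  qed
  then have "(\<lambda>t. max 0 (f t)) \<longlonglongrightarrow> 0" by (rule tendsto_max_0)
  moreover have "?N t \<le> (5 / 4 + ?A t + max 0 (f t)) * real (r t)" if "t \<ge> 1" for t
  proof -
    have r: "real (r t) > 0" using assms(2) that by fastforce
    have "?N t / real (r t) \<le> 5 / 4 + ?A t + max 0 (f t)" unfolding f_def by simp
    then show ?thesis using r by (simp add: pos_divide_le_eq)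
  qed
  ultimately show "\<exists>\<epsilon> :: nat \<Rightarrow> real. \<epsilon> \<longlonglongrightarrow> 0 \<and> (\<forall>t\<ge>1. ?N t \<le> (5 / 4 + ?A t + \<epsilon> t) * real (r t))"
    by blast
qed

end
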